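(* The Myerson interaction index $MI$ is the unique graph interaction index (defined for all finite player sets $N\in\mathcal N$, all games $(N,v)\in G$ and all undirected graphs $\Gamma\in\mathcal G^N$) that satisfies the five axioms $I$-Component Efficiency ($I$-CE), $I$-Fairness ($I$-F), $I$-Graph Null ($I$-GN), $I$-Linearity ($I$-L) and $I$-Strong Reduced Veto Partnership Consistency ($I$-SRVPC). That is, $MI$ is a graph interaction index satisfying these five axioms, and if $GI$ is any graph interaction index satisfying these five axioms, then $GI^{v,\Gamma}(S)=MI^{v,\Gamma}(S)$ for every $N\in\mathcal N$, every $(N,v)\in G$, every $\Gamma\in\mathcal G^N$ and every non-empty $S\subseteq N$.
   Context: **Games.** Let $\mathcal U=\{1,2,\dots\}$ be the universe of players and $\mathcal N$ the class of all non-empty finite subsets of $\mathcal U$. For $N\in\mathcal N$, a (TU) game is a pair $(N,v)$ with $v:2^N\to\mathbb R$, $v(\emptyset)=0$; $G^N$ is the set of all such games and $G=\bigcup_{N\in\mathcal N}G^N$. Small letters $n,s,t,\dots$ denote the cardinalities of $N,S,T,\dots$, and a singleton $\{i\}$ is written $i$. For $C\subseteq N$, $v|_C$ is the restriction of $v$ to the subsets of $C$. For non-empty $C\subseteq N$, the quotient game $v_{[C]}$ has player set $[C]\cup(N\setminus C)$, where $C$ is replaced by a single proxy player $[C]$ (regarded as a player, i.e. an element of the universe outside $N\setminus C$, so that quotient games belong to $G$), with $v_{[C]}(S)=v(S)$ and $v_{[C]}(S\cup[C])=v(S\cup C)$ for all $S\subseteq N\setminus C$. **Graphs.** $\mathcal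 G^N$ is the set of undirected graphs $\Gamma=(N,E)$ with node set $N$ and $E\subseteq\{\{i,j\}: i,j\in N,\ i\ne j\}$. For $S\subseteq N$, $\Gamma_S=(S,E[S])$ is the induced subgraph. $\mathcal K_\Gamma$ is the collection of (node sets of) connected components of $\Gamma$, and $\mathcal K_\Gamma(S)$ that of $\Gamma_S$. For $\{i,j\}\in E$, $\Gamma_{-\{i,j\}}=(N,E\setminus\{\{i,j\}\})$. For non-empty $C\subseteq N$, the quotient graph $\Gamma_{[C]}$ has node set $[C]\cup(N\setminus C)$ and edge set $E[N\setminus C]\cup\{\{[C],j\}: j\in N\setminus C,\ \{i,j\}\in E\text{ for some }i\in C\}$. For non-empty $S\subseteq N$, an induced subgraph $\Gamma_R$ is a minimal $S$-connecting subgraph if it connects $S$ (i.e. $S\subseteq R$ and any two nodes of $S$ are connected in $\Gamma_R$) and no $\Gamma_{R'}$ with $R'\subsetneq R$ connects $S$. If $S_1,\dots,S_\ell$ are the node sets of all minimal $S$-connecting subgraphs, the set of intermediaries of $S$ is $B_\Gamma(S)=\left(\bigcup_{m=1}^{\ell} S_m\right)\setminus S$ and the set of essential intermediaries of $S$ is $EB_\Gamma(S)=\left(\bigcap_{m=1}^{\ell} S_m\right)\setminus S$. **Myerson interaction index.** The graph-restricted game is $v^\Gamma(S)=\sum_{C\in\mathcal K_\Gamma(S)}v(C)$, $S\subseteq N$. The Shapley interaction index of a game $v\in G^N$ is, for non-empty $S\subseteq N$, $$SI^v(S)=\sum_{T\subseteq N\setminus S}\frac{(n-t-s)!\,t!}{(n-s+1)!}\sum_{L\subseteq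 S}(-1)^{s-l}v(T\cup L).$$ The Myerson interaction index is $MI^{v,\Gamma}(S)=SI^{v^\Gamma}(S)$. **Graph interaction indices.** A graph interaction index $GI$ assigns a real number $GI^{v,\Gamma}(S)$ (also written $I^{v,\Gamma}(S)$) to every $N\in\mathcal N$, $(N,v)\in G$, $\Gamma\in\mathcal G^N$ and non-empty $S\subseteq N$, such that: (1) $GI^{v,\Gamma}(S)=0$ whenever $S$ is not contained in any single $C\in\mathcal K_\Gamma$; (2) $GI^{v,\Gamma}(S)=GI^{v|_C,\Gamma_C}(S)$ whenever $S\subseteq C$ with $C\in\mathcal K_\Gamma$. **Graph null players and veto graph partnerships.** The following definitions are for connected $\Gamma$; if $\Gamma$ is disconnected they are applied to each connected component, i.e. to $(C,v|_C,\Gamma_C)$ for each $C\in\mathcal K_\Gamma$. A player $i$ is null in $v$ if $v(S\cup i)=v(S)$ for all $S\subseteq N\setminus i$; $D_0(v)$ is the set of null players of $v$. A player $i\in N$ is a graph null player in $(N,v,\Gamma)$ if $i$ is null in $v$ and, for every pair $j\ne k$ in $N\setminus i$ with $i\in B_\Gamma(\{j,k\})$, either $j\in D_0(v)$ or $k\in D_0(v)$. The set of graph null players is $D_0^\Gamma(v)$. A non-empty $P\subseteq N$ is a veto partnership in $(N,v)$ if $v(T\cup S)=v(T)=0$ for all $T\subseteq N\setminus P$ and all $S\subsetneq P$. A non-empty $GP\subseteq N$ is a veto graph partnership in $(N,v,\Gamma)$ if there is a veto partnership $P\neq\emptyset$ in $(N,v)$ with $GP\subseteq P\cup EB_\Gamma(P)$.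 **Axioms** for a graph interaction index, required for all $N\in\mathcal N$, all games $(N,v)\in G$ and all $\Gamma=(N,E)\in\mathcal G^N$: - $I$-CE: $\sum_{i\in C}I^{v,\Gamma}(i)=v(C)$ for all $C\in\mathcal K_\Gamma$. - $I$-GN: $I^{v,\Gamma}(S\cup i)=0$ for all $S\subseteq N\setminus i$ and every graph null player $i\in D_0^\Gamma(v)$. - $I$-F: $I^{v,\Gamma}(S\cup i)-I^{v,\Gamma_{-\{i,j\}}}(S\cup i)=I^{v,\Gamma}(S\cup j)-I^{v,\Gamma_{-\{i,j\}}}(S\cup j)$ for every edge $\{i,j\}\in E$ and all $S\subseteq N\setminus\{i,j\}$. - $I$-SRVPC: $I^{v,\Gamma}(P\cup S)=I^{v^\Gamma_{[P]},\Gamma_{[P]}}([P]\cup S)$ for every veto graph partnership $P\subseteq N$ of $(N,v,\Gamma)$ and all $S\subseteq N\setminus P$, where $v^\Gamma_{[P]}$ is the quotient with respect to $P$ of the graph-restricted game $v^\Gamma$ and $\Gamma_{[P]}$ is the quotient graph. - $I$-L: $I^{\alpha_1v_1+\alpha_2v_2,\Gamma}(S)=\alpha_1I^{v_1,\Gamma}(S)+\alpha_2I^{v_2,\Gamma}(S)$ for all $\alpha_1,\alpha_2\in\mathbb R$, all $(N,v_1),(N,v_2)\in G$ with the same player set and all non-empty $S\subseteq N$. *)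

theory Defs
  imports Complex_Main "HOL-Library.FuncSet"
begin

type_synonym player = nat
type_synonym tu_game = "player set \<Rightarrow> real"
type_synonym edges = "player set set"

definition universe :: "player set" where
  "universe = {1..}"

definition player_sets :: "player set set" where
  "player_sets = {N. N \<noteq> {} \<and> finite N \<and> N \<subseteq> universe}"


subsection \<open>Games\<close>

text \<open>
  A game on \<open>N\<close> is a function on \<open>Pow N\<close>, represented extensionally: it is \<open>undefined\<close> off \<open>Pow N\<close>,
  so that equal games are equal functions. All operations on games below end with a
  restriction to the power set of the player set for this reason.
\<close>

definition games :: "player set \<Rightarrow> tu_game set" where
  "games N = {v \<in> extensional (Pow N). v {} = 0}"

definition subgame :: "tu_game \<Rightarrow> player set \<Rightarrow> tu_game" where
  "subgame v C = restrict v (Pow C)"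

definition lin_comb :: "player set \<Rightarrow> real \<Rightarrow> tu_game \<Rightarrow> real \<Rightarrow> tu_game \<Rightarrow> tu_game" where
  "lin_comb N \<alpha>\<^sub>1 v\<^sub>1 \<alpha>\<^sub>2 v\<^sub>2 = (\<lambda>S\<in>Pow N. \<alpha>\<^sub>1 * v\<^sub>1 S + \<alpha>\<^sub>2 * v\<^sub>2 S)"

text \<open>
  The proxy player that replaces \<open>C\<close> has to be some player outside \<open>N - C\<close>; it may be a member
  of \<open>C\<close>. A proxy choice fixes this player for every \<open>N\<close> and \<open>C\<close>.
\<close>

definition proxy_choice :: "(player set \<Rightarrow> player set \<Rightarrow> player) \<Rightarrow> bool" where
  "proxy_choice proxy \<longleftrightarrow>
     (\<forall>N\<in>player_sets. \<forall>C. C \<noteq> {} \<and> C \<subseteq> N \<longrightarrow> proxy N C \<in> universe - (N - C))"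

definition quotient_players :: "player set \<Rightarrow> player set \<Rightarrow> player \<Rightarrow> player set" where
  "quotient_players N C p = insert p (N - C)"

definition quotient_game :: "player set \<Rightarrow> tu_game \<Rightarrow> player set \<Rightarrow> player \<Rightarrow> tu_game" where
  "quotient_game N v C p =
     (\<lambda>S\<in>Pow (quotient_players N C p). if p \<in> S then v ((S - {p}) \<union> C) else v S)"

definition null_player :: "player set \<Rightarrow> tu_game \<Rightarrow> player \<Rightarrow> bool" where
  "null_player N v i \<longleftrightarrow> i \<in> N \<and> (\<forall>S. S \<subseteq> N - {i} \<longrightarrow> v (insert i S) = v S)"

definition veto_partnership :: "player set \<Rightarrow> tu_game \<Rightarrow> player set \<Rightarrow> bool" where
  "veto_partnership N v P \<longleftrightarrow> P \<noteq> {} \<and> P \<subseteq> N \<and>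
     (\<forall>T S. T \<subseteq> N - P \<and> S \<subset> P \<longrightarrow> v (T \<union> S) = v T \<and> v T = 0)"


subsection \<open>Graphs\<close>

definition graphs :: "player set \<Rightarrow> edges set" where
  "graphs N = {E. E \<subseteq> {{i, j} | i j. i \<in> N \<and> j \<in> N \<and> i \<noteq> j}}"

definition induced :: "edges \<Rightarrow> player set \<Rightarrow> edges" where
  "induced E S = {e \<in> E. e \<subseteq> S}"

definition connection :: "player set \<Rightarrow> edges \<Rightarrow> (player \<times> player) set" where
  "connection N E = {(i, j). i \<in> N \<and> j \<in> N \<and> (i, j) \<in> {(a, b). {a, b} \<in> E}\<^sup>*}"

definition components :: "player set \<Rightarrow> edges \<Rightarrow> player set set" where
  "components N E = N // connection N E"

definition quotient_graph :: "player set \<Rightarrow> edges \<Rightarrow> player set \<Rightarrow> player \<Rightarrow> edges" where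
  "quotient_graph N E C p =
     induced E (N - C) \<union> {{p, j} | j. j \<in> N - C \<and> (\<exists>i\<in>C. {i, j} \<in> E)}"

definition connects :: "player set \<Rightarrow> edges \<Rightarrow> player set \<Rightarrow> player set \<Rightarrow> bool" where
  "connects N E S R \<longleftrightarrow> R \<subseteq> N \<and> S \<subseteq> R \<and>
     (\<forall>i\<in>S. \<forall>j\<in>S. (i, j) \<in> connection R (induced E R))"

definition minimal_connectors :: "player set \<Rightarrow> edges \<Rightarrow> player set \<Rightarrow> player set set" where
  "minimal_connectors N E S = {R. connects N E S R \<and> (\<forall>R'. R' \<subset> R \<longrightarrow> \<not> connects N E S R')}"

definition intermediaries :: "player set \<Rightarrow> edges \<Rightarrow> player set \<Rightarrow> player set" where
  "intermediaries N E S = \<Union> (minimal_connectors N E S) - S"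

text \<open>
  Meaningful when \<open>S\<close> lies in one component: otherwise there is no connecting subgraph and the
  intersection is \<open>UNIV\<close>. Below it is only used for connected graphs.
\<close>

definition essential_intermediaries :: "player set \<Rightarrow> edges \<Rightarrow> player set \<Rightarrow> player set" where
  "essential_intermediaries N E S = \<Inter> (minimal_connectors N E S) - S"


subsection \<open>Graph null players and veto graph partnerships\<close>

text \<open>
  The auxiliary \<open>_conn\<close> notions are the definitions for a connected graph; the actual notions
  apply them to each component (for a connected graph, \<open>N\<close> is the only one).
\<close>

definition graph_null_player_conn :: "player set \<Rightarrow> tu_game \<Rightarrow> edges \<Rightarrow> player \<Rightarrow> bool" where
  "graph_null_player_conn N v E i \<longleftrightarrow> null_player N v i \<and>
     (\<forall>j\<in>N - {i}. \<forall>k\<in>N - {i}. j \<noteq> k \<and> i \<in> intermediaries N E {j, k} \<longrightarrow>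
        null_player N v j \<or> null_player N v k)"

definition graph_null_player :: "player set \<Rightarrow> tu_game \<Rightarrow> edges \<Rightarrow> player \<Rightarrow> bool" where
  "graph_null_player N v E i \<longleftrightarrow>
     (\<exists>C\<in>components N E. graph_null_player_conn C (subgame v C) (induced E C) i)"

definition veto_graph_partnership_conn ::
    "player set \<Rightarrow> tu_game \<Rightarrow> edges \<Rightarrow> player set \<Rightarrow> bool" where
  "veto_graph_partnership_conn N v E GP \<longleftrightarrow> GP \<noteq> {} \<and> GP \<subseteq> N \<and>
     (\<exists>P. veto_partnership N v P \<and> GP \<subseteq> P \<union> essential_intermediaries N E P)"

definition veto_graph_partnership :: "player set \<Rightarrow> tu_game \<Rightarrow> edges \<Rightarrow> player set \<Rightarrow> bool" where
  "veto_graph_partnership N v E GP \<longleftrightarrow>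
     (\<exists>C\<in>components N E. veto_graph_partnership_conn C (subgame v C) (induced E C) GP)"


subsection \<open>The Myerson interaction index\<close>

definition restricted_game :: "player set \<Rightarrow> tu_game \<Rightarrow> edges \<Rightarrow> tu_game" where
  "restricted_game N v E = (\<lambda>S\<in>Pow N. \<Sum>C\<in>components S (induced E S). v C)"

definition SI :: "player set \<Rightarrow> tu_game \<Rightarrow> player set \<Rightarrow> real" where
  "SI N v S =
     (\<Sum>T\<in>Pow (N - S).
        fact (card N - card T - card S) * fact (card T) / fact (card N - card S + 1) *
        (\<Sum>L\<in>Pow S. (-1) ^ (card S - card L) * v (T \<union> L)))"

text \<open>
  An index is a function of the player set, the game, the edge set and the coalition; only its
  values at \<open>N \<in> player_sets\<close>, \<open>v \<in> games N\<close>, \<open>E \<in> graphs N\<close> and non-empty \<open>S \<subseteq> N\<close> matter.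
\<close>

type_synonym index = "player set \<Rightarrow> tu_game \<Rightarrow> edges \<Rightarrow> player set \<Rightarrow> real"

definition MI :: index where
  "MI N v E S = SI N (restricted_game N v E) S"


subsection \<open>Graph interaction indices and the axioms\<close>

definition graph_interaction_index :: "index \<Rightarrow> bool" where
  "graph_interaction_index I \<longleftrightarrow>
     (\<forall>N\<in>player_sets. \<forall>v\<in>games N. \<forall>E\<in>graphs N. \<forall>S. S \<noteq> {} \<and> S \<subseteq> N \<longrightarrow>
        ((\<forall>C\<in>components N E. \<not> S \<subseteq> C) \<longrightarrow> I N v E S = 0) \<and>
        (\<forall>C\<in>components N E. S \<subseteq> C \<longrightarrow> I N v E S = I C (subgame v C) (induced E C) S))"

definition component_efficiency :: "index \<Rightarrow> bool" where
  "component_efficiency I \<longleftrightarrow>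
     (\<forall>N\<in>player_sets. \<forall>v\<in>games N. \<forall>E\<in>graphs N. \<forall>C\<in>components N E.
        (\<Sum>i\<in>C. I N v E {i}) = v C)"

definition graph_null :: "index \<Rightarrow> bool" where
  "graph_null I \<longleftrightarrow>
     (\<forall>N\<in>player_sets. \<forall>v\<in>games N. \<forall>E\<in>graphs N. \<forall>i. graph_null_player N v E i \<longrightarrow>
        (\<forall>S. S \<subseteq> N - {i} \<longrightarrow> I N v E (insert i S) = 0))"

definition fairness :: "index \<Rightarrow> bool" where
  "fairness I \<longleftrightarrow>
     (\<forall>N\<in>player_sets. \<forall>v\<in>games N. \<forall>E\<in>graphs N. \<forall>i j. {i, j} \<in> E \<longrightarrow>
        (\<forall>S. S \<subseteq> N - {i, j} \<longrightarrow>
           I N v E (insert i S) - I N v (E - {{i, j}}) (insert i S) =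
           I N v E (insert j S) - I N v (E - {{i, j}}) (insert j S)))"

definition linearity :: "index \<Rightarrow> bool" where
  "linearity I \<longleftrightarrow>
     (\<forall>N\<in>player_sets. \<forall>v\<^sub>1\<in>games N. \<forall>v\<^sub>2\<in>games N. \<forall>E\<in>graphs N. \<forall>\<alpha>\<^sub>1 \<alpha>\<^sub>2 S.
        S \<noteq> {} \<and> S \<subseteq> N \<longrightarrow>
        I N (lin_comb N \<alpha>\<^sub>1 v\<^sub>1 \<alpha>\<^sub>2 v\<^sub>2) E S = \<alpha>\<^sub>1 * I N v\<^sub>1 E S + \<alpha>\<^sub>2 * I N v\<^sub>2 E S)"

definition strong_reduced_veto_partnership_consistency ::
    "(player set \<Rightarrow> player set \<Rightarrow> player) \<Rightarrow> index \<Rightarrow> bool" where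
  "strong_reduced_veto_partnership_consistency proxy I \<longleftrightarrow>
     (\<forall>N\<in>player_sets. \<forall>v\<in>games N. \<forall>E\<in>graphs N. \<forall>P. veto_graph_partnership N v E P \<longrightarrow>
        (\<forall>S. S \<subseteq> N - P \<longrightarrow>
           (let p = proxy N P in
              I N v E (P \<union> S) =
              I (quotient_players N P p) (quotient_game N (restricted_game N v E) P p)
                (quotient_graph N E P p) (insert p S))))"

definition myerson_axioms :: "(player set \<Rightarrow> player set \<Rightarrow> player) \<Rightarrow> index \<Rightarrow> bool" where
  "myerson_axioms proxy I \<longleftrightarrow> component_efficiency I \<and> fairness I \<and> graph_null I \<and> linearity I \<and>
     strong_reduced_veto_partnership_consistency proxy I"

end

theory Submission
  imports Defs
begin

text \<open>
  Both parts of the proof work with Harsanyi dividends. The Shapley interaction index of \<open>S\<close> is the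
  sum of \<open>\<Delta>(T) / (t - s + 1)\<close> over \<open>T \<supseteq> S\<close>, and the dividend of the graph-restricted game vanishes
  on disconnected \<open>T\<close>. Hence each axiom for \<open>MI\<close> reduces to comparing dividends: a graph null player
  is null in \<open>v\<^sup>\<Gamma>\<close>, and for a veto graph partnership \<open>P\<close> the dividends of \<open>v\<^sup>\<Gamma>\<close> within the
  component of \<open>P\<close> vanish except on sets that contain \<open>P\<close>; moreover the quotient of \<open>v\<^sup>\<Gamma>\<close> equals
  its own restriction to the quotient graph.

  Uniqueness is by induction on the number of players, then on the number of edges, for unanimity
  games \<open>u\<^sub>T\<close> on connected graphs. By fairness and the induction hypothesis the difference \<open>f\<close> of two
  indices satisfies \<open>f(S \<union> i) = f(S \<union> j)\<close> for each edge, so \<open>f(S)\<close> depends only on \<open>|S|\<close>. It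
  vanishes for \<open>|S| = 1\<close> by component efficiency. For \<open>|S| \<ge> 2\<close> one set of each size suffices: if
  \<open>|T| \<ge> 2\<close>, a set that contains two members of \<open>T\<close>, which may be merged as they form a veto graph
  partnership; if \<open>|T| = 1\<close>, every set, since all players outside \<open>T\<close> are graph null.
\<close>

section \<open>Harsanyi dividends\<close>

text \<open>The Moebius transform of \<open>v\<close> on finite sets. It asks for no game property,
  so that it also applies to functions of one block of players, such as
  \<open>\<lambda>R. dividend (\<lambda>L. v (L \<union> R)) A\<close>.\<close>

definition dividend :: "('a set \<Rightarrow> real) \<Rightarrow> 'a set \<Rightarrow> real" where
  "dividend v T = (\<Sum>L\<in>Pow T. (-1) ^ (card T - card L) * v L)"

lemma dividend_cong:
  assumes "\<And>L. L \<subseteq> T \<Longrightarrow> v L = w L"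
  shows "dividend v T = dividend w T"
  unfolding dividend_def using assms by (auto intro: sum.cong)

lemma dividend_zero: "(\<And>L. L \<subseteq> T \<Longrightarrow> v L = 0) \<Longrightarrow> dividend v T = 0"
  unfolding dividend_def by (auto intro: sum.neutral)

lemma dividend_diff: "dividend (\<lambda>L. v L - w L) T = dividend v T - dividend w T"
  unfolding dividend_def by (simp add: right_diff_distrib sum_subtractf)

lemma dividend_add: "dividend (\<lambda>L. v L + w L) T = dividend v T + dividend w T"
  unfolding dividend_def by (simp add: distrib_left sum.distrib)

lemma dividend_empty [simp]: "dividend v {} = v {}"
  by (simp add: dividend_def)

lemma sum_Pow_insert:
  assumes "finite A" "x \<notin> A"
  shows "sum f (Pow (insert x A)) = sum f (Pow A) + (\<Sum>L\<in>Pow A. f (insert x L))"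
proof -
  have "inj_on (insert x) (Pow A)"
    using assms(2) by (auto simp: inj_on_def)
  then have "sum f (insert x ` Pow A) = (\<Sum>L\<in>Pow A. f (insert x L))"
    by (simp add: sum.reindex)
  moreover have "sum f (Pow A \<union> insert x ` Pow A) = sum f (Pow A) + sum f (insert x ` Pow A)"
    using assms by (intro sum.union_disjoint) auto
  ultimately show ?thesis
    by (simp add: Pow_insert)
qed

text \<open>Pairing \<open>L\<close> with \<open>insert x L\<close>, whose signs are opposite, shows
  a dividend to be an iterated difference; this drives the inductions below.\<close>

lemma dividend_insert:
  assumes "finite T" "x \<notin> T"
  shows "dividend v (insert x T) = dividend (\<lambda>L. v (insert x L) - v L) T"
proof -
  have "(-1) ^ (card (insert x T) - card L) * v L = - ((-1) ^ (card T - card L) * v L)"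
    if "L \<in> Pow T" for L
    using that assms by (simp add: Suc_diff_le card_mono)
  moreover have "(-1) ^ (card (insert x T) - card (insert x L)) * v (insert x L)
      = (-1) ^ (card T - card L) * v (insert x L)" if "L \<in> Pow T" for L
  proof -
    have "finite L" "x \<notin> L" using that assms by (auto intro: finite_subset)
    then show ?thesis using assms by simp
  qed
  ultimately have "dividend v (insert x T) = (\<Sum>L\<in>Pow T. - ((-1) ^ (card T - card L) * v L))
      + (\<Sum>L\<in>Pow T. (-1) ^ (card T - card L) * v (insert x L))"
    unfolding dividend_def sum_Pow_insert[OF assms] by (intro arg_cong2[of _ _ _ _ "(+)"] sum.cong refl)
  then show ?thesis
    unfolding dividend_def by (simp add: right_diff_distrib sum_subtractf sum_negf)
qed

text \<open>Moebius inversion. The subsets without \<open>x\<close> add up to \<open>v A\<close>,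
  those with \<open>x\<close> to \<open>v (insert x A) - v A\<close> by the induction hypothesis for
  the difference function.\<close>

lemma sum_dividend:
  assumes "finite A"
  shows "(\<Sum>T\<in>Pow A. dividend v T) = v A"
  using assms
proof (induction A arbitrary: v rule: finite_induct)
  case (insert x A)
  have "(\<Sum>T\<in>Pow A. dividend v (insert x T)) = (\<Sum>T\<in>Pow A. dividend (\<lambda>L. v (insert x L) - v L) T)"
    using insert.hyps by (intro sum.cong refl dividend_insert) (auto intro: finite_subset)
  then show ?case
    using insert by (simp add: sum_Pow_insert)
qed simp

lemma sum_dividend_nonempty:
  assumes "finite A" "v {} = 0"
  shows "(\<Sum>T\<in>Pow A - {{}}. dividend v T) = v A"
  using assms sum_dividend[OF assms(1), of v] by (simp add: sum_diff1)

lemma dividend_Un: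
  assumes "finite B" "finite A" "A \<inter> B = {}"
  shows "dividend v (A \<union> B) = dividend (\<lambda>R. dividend (\<lambda>L. v (L \<union> R)) A) B"
  using assms
proof (induction B arbitrary: v rule: finite_induct)
  case (insert x B)
  have "dividend v (A \<union> insert x B) = dividend (\<lambda>L. v (insert x L) - v L) (A \<union> B)"
    using insert by (simp add: dividend_insert)
  also have "\<dots> = dividend (\<lambda>R. dividend (\<lambda>L. v (insert x (L \<union> R)) - v (L \<union> R)) A) B"
    using insert by simp
  also have "\<dots> = dividend (\<lambda>R. dividend (\<lambda>L. v (L \<union> R)) A) (insert x B)"
    using insert by (simp add: dividend_insert dividend_diff)
  finally show ?case .
qed simp

lemma dividend_const:
  assumes "finite T" "T \<noteq> {}"
  shows "dividend (\<lambda>_. c) T = 0"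
proof -
  obtain x T' where "T = insert x T'" "x \<notin> T'" "finite T'"
    using assms by (metis finite.cases finite_insert insert_absorb mk_disjoint_insert)
  then show ?thesis
    by (simp add: dividend_insert dividend_zero)
qed

text \<open>Differences over \<open>X\<close> remove the summand \<open>w R\<close> and leave a
  value that does not depend on \<open>R\<close>; differences over \<open>Y\<close> then remove that
  value.\<close>

lemma dividend_additive:
  assumes "finite X" "finite Y" "X \<inter> Y = {}" "X \<noteq> {}" "Y \<noteq> {}"
    and add: "\<And>L R. L \<subseteq> X \<Longrightarrow> R \<subseteq> Y \<Longrightarrow> w (L \<union> R) = w L + w R"
  shows "dividend w (X \<union> Y) = 0"
proof -
  have "dividend (\<lambda>L. w (L \<union> R)) X = dividend w X" if "R \<subseteq> Y" for R
  proof -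
    have "dividend (\<lambda>L. w (L \<union> R)) X = dividend (\<lambda>L. w L + w R) X"
      using that by (intro dividend_cong add)
    then show ?thesis
      using assms by (simp add: dividend_add dividend_const)
  qed
  then have "dividend w (X \<union> Y) = dividend (\<lambda>R. dividend w X) Y"
    using assms by (simp add: dividend_Un cong: dividend_cong)
  then show ?thesis
    using assms by (simp add: dividend_const)
qed


section \<open>The Shapley interaction index\<close>

text \<open>
  With \<open>a = |A|\<close> and \<open>k = |X|\<close>, each summand is the Beta integral of \<open>(1 - x)\<^bsup>a-k\<^esup> x\<^bsup>b+k\<^esup>\<close> over
  \<open>[0, 1]\<close>, and these integrands add up to \<open>x\<^sup>b\<close>.
\<close>

lemma sum_Pow_fact:
  assumes "finite A"
  shows "(\<Sum>X\<in>Pow A. fact (card A - card X) * fact (b + card X) / fact (card A + b + 1))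
    = 1 / (real b + 1)"
  using assms
proof (induction A rule: finite_induct)
  case empty
  show ?case by (simp add: field_simps add_nonneg_eq_0_iff)
next
  case (insert x A)
  let ?a = "card A"
  \<comment> \<open>The factors \<open>Suc c\<close> and \<open>Suc (b + card X)\<close> of the two
    larger factorials sum to the last factor of the denominator and cancel it; for the integrands
    this is (1 - z) + z = 1.\<close>
  have step: "fact (Suc ?a - card X) * fact (b + card X) / fact (Suc ?a + b + 1)
      + fact (Suc ?a - card (insert x X)) * fact (b + card (insert x X)) / fact (Suc ?a + b + 1)
      = (fact (?a - card X) * fact (b + card X) / fact (?a + b + 1) :: real)"
    if "X \<in> Pow A" for X
  proof -
    have X: "finite X" "x \<notin> X" "card X \<le> ?a"
      using that insert by (auto intro: finite_subset card_mono)
    define c where "c = ?a - card X"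
    have c: "?a = c + card X" using X by (simp add: c_def)
    have "fact (Suc ?a - card X) * fact (b + card X) / fact (Suc ?a + b + 1)
      + fact (Suc ?a - card (insert x X)) * fact (b + card (insert x X)) / fact (Suc ?a + b + 1)
      = (fact c * fact (b + card X) * (real (Suc c) + real (Suc (b + card X)))
        / fact (Suc ?a + b + 1) :: real)"
      using X c by (simp add: add_divide_distrib [symmetric] algebra_simps)
    also have "real (Suc c) + real (Suc (b + card X)) = real (Suc ?a + b + 1)"
      by (simp add: c)
    also have "fact c * fact (b + card X) * real (Suc ?a + b + 1) / fact (Suc ?a + b + 1)
      = (fact c * fact (b + card X) / fact (?a + b + 1) :: real)"
      by (simp add: divide_simps del: of_nat_Suc)
    finally show ?thesis by (simp add: c_def)
  qed
  let ?F = "\<lambda>X. fact (Suc ?a - card X) * fact (b + card X) / fact (Suc ?a + b + 1) :: real"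
  have "(\<Sum>X\<in>Pow (insert x A). ?F X) = (\<Sum>X\<in>Pow A. ?F X + ?F (insert x X))"
    by (simp only: sum_Pow_insert[OF insert.hyps] sum.distrib)
  also have "\<dots> = (\<Sum>X\<in>Pow A. fact (?a - card X) * fact (b + card X) / fact (?a + b + 1))"
    by (intro sum.cong refl step)
  also have "\<dots> = 1 / (real b + 1)" by (rule insert.IH)
  finally show ?case by (simp only: card_insert_disjoint[OF insert.hyps])
qed

text \<open>For fixed \<open>T\<close> the inner alternating sum is a dividend over
  \<open>S\<close>, and Moebius inversion in \<open>T\<close> turns it into a sum over
  \<open>T' \<subseteq> T\<close>. After exchanging the sums,
  \<open>dividend v (S \<union> T')\<close> carries the total weight of the supersets of
  \<open>T'\<close>, which \<open>sum_Pow_fact\<close> evaluates.\<close>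

lemma SI_dividend:
  assumes "finite N" "S \<subseteq> N"
  shows "SI N v S = (\<Sum>T\<in>Pow (N - S). dividend v (S \<union> T) / (real (card T) + 1))"
proof -
  let ?M = "N - S"
  let ?m = "card ?M"
  let ?W = "\<lambda>T. fact (?m - card T) * fact (card T) / fact (?m + 1) :: real"
  have fin: "finite ?M" "finite S"
    using assms by (auto intro: finite_subset)
  then have m: "?m = card N - card S"
    using assms by (simp add: card_Diff_subset)
  have "SI N v S = (\<Sum>T\<in>Pow ?M. ?W T * dividend (\<lambda>L. v (T \<union> L)) S)"
    unfolding SI_def dividend_def m by (simp add: add.commute)
  also have "\<dots> = (\<Sum>T\<in>Pow ?M. \<Sum>T'\<in>Pow T. ?W T * dividend v (S \<union> T'))"
  proof (intro sum.cong refl)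
    fix T assume "T \<in> Pow ?M"
    then have T: "finite T" "S \<inter> T = {}" using fin by (auto intro: finite_subset)
    have "dividend (\<lambda>L. v (T \<union> L)) S
        = (\<Sum>T'\<in>Pow T. dividend (\<lambda>T. dividend (\<lambda>L. v (T \<union> L)) S) T')"
      using sum_dividend[OF T(1)] by simp
    also have "\<dots> = (\<Sum>T'\<in>Pow T. dividend v (S \<union> T'))"
    proof (intro sum.cong refl)
      fix T' assume "T' \<in> Pow T"
      then have "finite T'" "S \<inter> T' = {}" using T by (auto intro: finite_subset)
      then show "dividend (\<lambda>T. dividend (\<lambda>L. v (T \<union> L)) S) T' = dividend v (S \<union> T')"
        using fin by (simp add: dividend_Un Un_commute)
    qed
    finally show "?W T * dividend (\<lambda>L. v (T \<union> L)) S
        = (\<Sum>T'\<in>Pow T. ?W T * dividend v (S \<union> T'))"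
      by (simp add: sum_distrib_left)
  qed
  also have "\<dots> = (\<Sum>T'\<in>Pow ?M. \<Sum>T | T' \<subseteq> T \<and> T \<subseteq> ?M. ?W T * dividend v (S \<union> T'))"
  proof -
    have "(\<Sum>T\<in>Pow ?M. \<Sum>T' | T' \<in> Pow ?M \<and> T' \<subseteq> T. ?W T * dividend v (S \<union> T'))
      = (\<Sum>T'\<in>Pow ?M. \<Sum>T | T \<in> Pow ?M \<and> T' \<subseteq> T. ?W T * dividend v (S \<union> T'))"
      using fin by (intro sum.swap_restrict) auto
    moreover have "{T'. T' \<in> Pow ?M \<and> T' \<subseteq> T} = Pow T" if "T \<in> Pow ?M" for T
      using that by auto
    moreover have "{T. T \<in> Pow ?M \<and> T' \<subseteq> T} = {T. T' \<subseteq> T \<and> T \<subseteq> ?M}" for T'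
      by auto
    ultimately show ?thesis by simp
  qed
  also have "\<dots> = (\<Sum>T'\<in>Pow ?M. dividend v (S \<union> T') / (real (card T') + 1))"
  proof (intro sum.cong refl)
    fix T' assume T': "T' \<in> Pow ?M"
    then have finT': "finite T'" using fin by (auto intro: finite_subset)
    \<comment> \<open>Supersets of \<open>T'\<close> are written as \<open>T' \<union> X\<close>
      with \<open>X\<close> disjoint from \<open>T'\<close>, so that \<open>sum_Pow_fact\<close>
      applies with \<open>b = card T'\<close>.\<close>
    have "(\<Sum>T | T' \<subseteq> T \<and> T \<subseteq> ?M. ?W T) = (\<Sum>X\<in>Pow (?M - T'). ?W (T' \<union> X))"
      using T' by (intro sum.reindex_bij_witness[of _ "\<lambda>X. T' \<union> X" "\<lambda>T. T - T'"])
        (auto simp: Un_absorb1)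
    also have "\<dots> = (\<Sum>X\<in>Pow (?M - T'). fact (card (?M - T') - card X) * fact (card T' + card X)
        / fact (card (?M - T') + card T' + 1))"
    proof (intro sum.cong refl)
      fix X assume X: "X \<in> Pow (?M - T')"
      have "card (T' \<union> X) = card T' + card X"
        using X finT' fin by (intro card_Un_disjoint) (auto intro: finite_subset)
      moreover have "card (?M - T') = ?m - card T'" "card T' \<le> ?m"
        using T' fin finT' by (auto simp: card_Diff_subset card_mono)
      ultimately show "?W (T' \<union> X) = fact (card (?M - T') - card X) * fact (card T' + card X)
        / fact (card (?M - T') + card T' + 1)"
        by simp
    qed
    also have "\<dots> = 1 / (real (card T') + 1)"
      using fin by (intro sum_Pow_fact) auto
    finally show "(\<Sum>T | T' \<subseteq> T \<and> T \<subseteq> ?M. ?W T * dividend v (S \<union> T'))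
        = dividend v (S \<union> T') / (real (card T') + 1)"
      by (simp only: sum_distrib_right [symmetric]) simp
  qed
  finally show ?thesis .
qed

text \<open>In this form the indices of different sets \<open>S\<close> are sums over the same
  dividends, as the comparisons for efficiency and fairness require.\<close>

lemma SI_dividend_superset:
  assumes "finite N" "S \<subseteq> N"
  shows "SI N v S = (\<Sum>U | S \<subseteq> U \<and> U \<subseteq> N. dividend v U / (real (card (U - S)) + 1))"
proof -
  have "(\<Sum>T\<in>Pow (N - S). dividend v (S \<union> T) / (real (card T) + 1))
    = (\<Sum>U | S \<subseteq> U \<and> U \<subseteq> N. dividend v U / (real (card (U - S)) + 1))"
    using assms(2)
    by (intro sum.reindex_bij_witness[of _ "\<lambda>U. U - S" "\<lambda>T. S \<union> T"])
      (auto simp: Un_absorb1 Un_Diff Diff_triv Int_commute intro!: arg_cong[of _ _ card])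
  then show ?thesis
    using assms by (simp add: SI_dividend)
qed

text \<open>The dividend of a non-empty \<open>U\<close> is shared equally among its members, so the
  sum over all players returns it once.\<close>

lemma SI_efficient:
  assumes "finite N" "v {} = 0"
  shows "(\<Sum>i\<in>N. SI N v {i}) = v N"
proof -
  have "(\<Sum>i\<in>N. SI N v {i}) = (\<Sum>i\<in>N. \<Sum>U | U \<in> Pow N \<and> i \<in> U. dividend v U / real (card U))"
  proof (intro sum.cong refl)
    fix i assume "i \<in> N"
    then have "SI N v {i} = (\<Sum>U | {i} \<subseteq> U \<and> U \<subseteq> N. dividend v U / (real (card (U - {i})) + 1))"
      using assms by (intro SI_dividend_superset) auto
    also have "\<dots> = (\<Sum>U | U \<in> Pow N \<and> i \<in> U. dividend v U / real (card U))"
    proof (intro sum.cong)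
      fix U assume "U \<in> {U. U \<in> Pow N \<and> i \<in> U}"
      then have "finite U" "i \<in> U" using assms by (auto intro: finite_subset)
      then have "card U = Suc (card (U - {i}))" by (rule card.remove)
      then show "dividend v U / (real (card (U - {i})) + 1) = dividend v U / real (card U)"
        by simp
    qed auto
    finally show "SI N v {i} = \<dots>" .
  qed
  also have "\<dots> = (\<Sum>U\<in>Pow N. \<Sum>i | i \<in> N \<and> i \<in> U. dividend v U / real (card U))"
    using assms by (intro sum.swap_restrict) auto
  also have "\<dots> = (\<Sum>U\<in>Pow N. dividend v U)"
  proof (intro sum.cong refl)
    fix U assume U: "U \<in> Pow N"
    then have "{i. i \<in> N \<and> i \<in> U} = U" "finite U" using assms by (auto intro: finite_subset)
    \<comment> \<open>The empty set has no members to share its dividend, which is zero by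
      \<open>v {} = 0\<close>.\<close>
    then show "(\<Sum>i | i \<in> N \<and> i \<in> U. dividend v U / real (card U)) = dividend v U"
      using assms by (cases "U = {}") auto
  qed
  finally show ?thesis
    using assms by (simp add: sum_dividend)
qed


section \<open>Connected node sets\<close>

abbreviation adj :: "edges \<Rightarrow> (player \<times> player) set" where
  "adj E \<equiv> {(a, b). {a, b} \<in> E}"

lemma induced_mono: "A \<subseteq> B \<Longrightarrow> induced E A \<subseteq> induced E B"
  by (auto simp: induced_def)

lemma induced_subset: "induced E A \<subseteq> E"
  by (auto simp: induced_def)

lemma induced_induced: "A \<subseteq> B \<Longrightarrow> induced (induced E B) A = induced E A"
  by (auto simp: induced_def)

lemma induced_graph: "E \<in> graphs N \<Longrightarrow> induced E N = E"
  by (fastforce simp: induced_def graphs_def)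

lemma graph_edge:
  assumes "E \<in> graphs N" "e \<in> E"
  obtains i j where "e = {i, j}" "i \<in> N" "j \<in> N" "i \<noteq> j"
  using assms by (auto simp: graphs_def)

lemma induced_in_graphs:
  assumes "E \<in> graphs N"
  shows "induced E A \<in> graphs A"
  unfolding graphs_def
proof (intro CollectI subsetI)
  fix e assume e: "e \<in> induced E A"
  then have "e \<in> E" by (simp add: induced_def)
  then obtain i j where "e = {i, j}" "i \<noteq> j" by (rule graph_edge[OF assms])
  with e show "\<exists>i j. e = {i, j} \<and> i \<in> A \<and> j \<in> A \<and> i \<noteq> j"
    by (auto simp: induced_def)
qed

lemma connection_iff: "(i, j) \<in> connection N E \<longleftrightarrow> i \<in> N \<and> j \<in> N \<and> (i, j) \<in> (adj E)\<^sup>*"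
  by (simp add: connection_def)

lemma equiv_connection: "equiv N (connection N E)"
proof (rule equivI)
  have "sym (adj E)" by (auto simp: sym_def insert_commute)
  then have "sym ((adj E)\<^sup>*)" by (rule sym_rtrancl)
  then show "sym (connection N E)" by (auto simp: sym_def connection_iff)
qed (auto simp: refl_on_def trans_def connection_iff)

lemma connection_sym: "(a, b) \<in> connection N E \<Longrightarrow> (b, a) \<in> connection N E"
  using equiv_connection by (meson equivE symD)

lemma connection_trans:
  "(a, b) \<in> connection N E \<Longrightarrow> (b, c) \<in> connection N E \<Longrightarrow> (a, c) \<in> connection N E"
  by (auto simp: connection_iff)

lemma connection_mono:
  assumes "A \<subseteq> B" "E \<subseteq> E'"
  shows "connection A E \<subseteq> connection B E'"
proof -
  have "(adj E)\<^sup>* \<subseteq> (adj E')\<^sup>*" using assms by (intro rtrancl_mono) auto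
  then show ?thesis using assms by (auto simp: connection_iff)
qed

text \<open>No edge leads out of \<open>X\<close> within \<open>A\<close>, so a path that starts in
  \<open>X\<close> stays there.\<close>

lemma connection_closed:
  assumes ab: "(a, b) \<in> connection A (induced E A)"
    and X: "a \<in> X" "X \<subseteq> A" "\<And>x y. x \<in> X \<Longrightarrow> y \<in> A - X \<Longrightarrow> {x, y} \<notin> E"
  shows "(a, b) \<in> connection X (induced E X)"
proof -
  have "(a, b) \<in> (adj (induced E A))\<^sup>*" using ab by (simp add: connection_iff)
  then show ?thesis
  proof induction
    case base
    show ?case using X by (simp add: connection_iff)
  next
    case (step y z)
    then have "y \<in> X" "{y, z} \<in> E" "z \<in> A" by (auto simp: connection_iff induced_def)
    then have "z \<in> X" using X by blast
    then have "(y, z) \<in> adj (induced E X)" using \<open>y \<in> X\<close> \<open>{y, z} \<in> E\<close> by (simp add: induced_def)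
    with step.IH have "(a, z) \<in> (adj (induced E X))\<^sup>*"
      by (auto simp: connection_iff intro: rtrancl_into_rtrancl)
    then show ?case using X(1) \<open>z \<in> X\<close> by (simp add: connection_iff)
  qed
qed

section \<open>Connected components\<close>

lemma component_props:
  assumes "C \<in> components N E"
  shows "C \<noteq> {}" "C \<subseteq> N"
    and "\<And>a b. a \<in> C \<Longrightarrow> b \<in> C \<Longrightarrow> (a, b) \<in> connection N E"
    and "\<And>a b. a \<in> C \<Longrightarrow> (a, b) \<in> connection N E \<Longrightarrow> b \<in> C"
proof -
  have C: "C \<in> N // connection N E" using assms by (simp add: components_def)
  note eq = equiv_connection[of N E]
  show "C \<noteq> {}" "C \<subseteq> N"
    using in_quotient_imp_non_empty[OF eq C] in_quotient_imp_subset[OF eq C] by auto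
  show "(a, b) \<in> connection N E" if "a \<in> C" "b \<in> C" for a b
    using in_quotient_imp_in_rel[OF eq C] that by simp
  show "b \<in> C" if "a \<in> C" "(a, b) \<in> connection N E" for a b
    using in_quotient_imp_closed[OF eq C that] .
qed

lemma component_closed:
  assumes "C \<in> components N E" "a \<in> C" "b \<in> N" "{a, b} \<in> E"
  shows "b \<in> C"
proof -
  have "(a, b) \<in> connection N E"
    using assms component_props(2)[OF assms(1)] by (auto simp: connection_iff)
  then show ?thesis using component_props(4) assms by blast
qed

lemma components_disjoint:
  "C \<in> components N E \<Longrightarrow> D \<in> components N E \<Longrightarrow> C \<noteq> D \<Longrightarrow> C \<inter> D = {}"
  unfolding components_def using quotient_disj[OF equiv_connection] by blast

lemma finite_components: "finite N \<Longrightarrow> finite (components N E)"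
  unfolding components_def
  by (rule finite_quotient) (auto simp: connection_def)

lemma Union_components: "\<Union> (components N E) = N"
  unfolding components_def by (rule Union_quotient[OF equiv_connection])

section \<open>Connecting node sets\<close>

lemma connectsI:
  "R \<subseteq> N \<Longrightarrow> S \<subseteq> R \<Longrightarrow> (\<And>i j. i \<in> S \<Longrightarrow> j \<in> S \<Longrightarrow> (i, j) \<in> connection R (induced E R)) \<Longrightarrow>
    connects N E S R"
  by (simp add: connects_def)

lemma connects_component:
  assumes "E \<in> graphs N" "C \<in> components N E"
  shows "connects N E C C"
proof (rule connectsI)
  fix i j assume "i \<in> C" "j \<in> C"
  then have "(i, j) \<in> connection N (induced E N)"
    using component_props(3)[OF assms(2)] assms(1) by (simp add: induced_graph)
  then show "(i, j) \<in> connection C (induced E C)"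
  proof (rule connection_closed)
    fix x y assume "x \<in> C" "y \<in> N - C"
    then show "{x, y} \<notin> E" using component_closed[OF assms(2), of x y] by blast
  qed (use \<open>i \<in> C\<close> component_props(2)[OF assms(2)] in auto)
qed (use component_props(2)[OF assms(2)] in auto)

lemma connects_subset_component:
  assumes "connects N E T T" "C \<in> components N E" "T \<inter> C \<noteq> {}"
  shows "T \<subseteq> C"
proof
  fix t assume "t \<in> T"
  obtain c where "c \<in> T" "c \<in> C" using assms by auto
  with \<open>t \<in> T\<close> have "(c, t) \<in> connection T (induced E T)" "T \<subseteq> N"
    using assms(1) by (auto simp: connects_def)
  then have "(c, t) \<in> connection N E"
    using connection_mono[OF \<open>T \<subseteq> N\<close> induced_subset] by blast
  then show "t \<in> C" using component_props(4)[OF assms(2)] \<open>c \<in> C\<close> by blast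
qed

lemma components_connected:
  assumes "connects N E A A" "A \<noteq> {}"
  shows "components A (induced E A) = {A}"
proof -
  have "connection A (induced E A) `` {a} = A" if "a \<in> A" for a
    using assms that by (auto simp: connects_def connection_iff)
  then show ?thesis using assms(2) by (auto simp: components_def quotient_def)
qed

lemma connects_mono:
  assumes "connects N E T A" "A \<subseteq> B" "B \<subseteq> N"
  shows "connects N E T B"
proof (rule connectsI)
  fix i j assume "i \<in> T" "j \<in> T"
  then have "(i, j) \<in> connection A (induced E A)" using assms(1) by (simp add: connects_def)
  then show "(i, j) \<in> connection B (induced E B)"
    using connection_mono[OF assms(2) induced_mono[OF assms(2)]] by blast
qed (use assms in \<open>auto simp: connects_def\<close>)

lemma connects_antimono: "connects N E T A \<Longrightarrow> T' \<subseteq> T \<Longrightarrow> connects N E T' A"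
  unfolding connects_def by blast

text \<open>A path cannot pass from one part to the other, so a single member of \<open>T\<close>
  decides which part holds and connects all of \<open>T\<close>.\<close>

lemma connects_Un:
  assumes "X \<union> Y \<subseteq> N" and no_edge: "\<And>x y. x \<in> X \<Longrightarrow> y \<in> Y \<Longrightarrow> {x, y} \<notin> E"
    and "T \<noteq> {}"
  shows "connects N E T (X \<union> Y) \<longleftrightarrow> connects N E T X \<or> connects N E T Y"
proof
  have *: "connects N E T X'"
    if T: "connects N E T (X' \<union> Y')" and t: "t \<in> T" "t \<in> X'"
      and e: "\<And>x y. x \<in> X' \<Longrightarrow> y \<in> Y' \<Longrightarrow> {x, y} \<notin> E" for X' Y' t
  proof -
    \<comment> \<open>It is enough to reach every member of \<open>T\<close> from \<open>t\<close>;
      symmetry and transitivity do the rest.\<close>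
    have tj: "(t, j) \<in> connection X' (induced E X')" if "j \<in> T" for j
    proof (rule connection_closed)
      show "(t, j) \<in> connection (X' \<union> Y') (induced E (X' \<union> Y'))"
        using T t(1) that by (simp add: connects_def)
    qed (use t e in auto)
    show ?thesis
    proof (rule connectsI)
      show "X' \<subseteq> N" using T by (simp add: connects_def)
      show "T \<subseteq> X'" using tj by (auto simp: connection_iff)
      show "(i, j) \<in> connection X' (induced E X')" if "i \<in> T" "j \<in> T" for i j
        using connection_trans[OF connection_sym[OF tj[OF that(1)]] tj[OF that(2)]] .
    qed
  qed
  assume T: "connects N E T (X \<union> Y)"
  then obtain t where t: "t \<in> T" "t \<in> X \<or> t \<in> Y"
    using assms(3) by (auto simp: connects_def)
  from t(2) show "connects N E T X \<or> connects N E T Y"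
  proof
    assume "t \<in> X"
    then have "connects N E T X" by (rule *[OF T t(1) _ no_edge])
    then show ?thesis ..
  next
    assume "t \<in> Y"
    moreover have "{x, y} \<notin> E" if "x \<in> Y" "y \<in> X" for x y
      using no_edge[OF that(2,1)] by (simp add: insert_commute)
    ultimately have "connects N E T Y"
      using *[of Y X t] T t(1) by (simp add: Un_commute)
    then show ?thesis ..
  qed
next
  assume "connects N E T X \<or> connects N E T Y"
  then show "connects N E T (X \<union> Y)"
    using connects_mono[of N E T X "X \<union> Y"] connects_mono[of N E T Y "X \<union> Y"] assms(1) by blast
qed

lemma obtains_minimal_connector:
  assumes "connects N E S A" "finite A"
  obtains R where "R \<in> minimal_connectors N E S" "R \<subseteq> A"
proof -
  let ?F = "{R. R \<subseteq> A \<and> connects N E S R}"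
  have "finite ?F" "A \<in> ?F" using assms by auto
  then obtain R where R: "R \<in> ?F" and min: "\<forall>R'\<in>?F. R' \<subseteq> R \<longrightarrow> R = R'"
    using finite_has_minimal2[of ?F A] by auto
  have "\<not> connects N E S R'" if "R' \<subset> R" for R'
  proof
    assume "connects N E S R'"
    then have "R' \<in> ?F" using R that by auto
    then have "R = R'" using min that by auto
    then show False using that by simp
  qed
  then have "R \<in> minimal_connectors N E S"
    using R by (simp add: minimal_connectors_def)
  with R show thesis by (intro that) auto
qed

text \<open>A minimal connector inside \<open>insert i A\<close> that avoided \<open>i\<close> would
  lie in \<open>A\<close>, and then \<open>A\<close> would connect the pair.\<close>

lemma intermediary_of_cut:
  assumes "connects N E {j, k} (insert i A)" "\<not> connects N E {j, k} A"
    and "finite A" "i \<noteq> j" "i \<noteq> k"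
  shows "i \<in> intermediaries N E {j, k}"
proof -
  obtain R where R: "R \<in> minimal_connectors N E {j, k}" "R \<subseteq> insert i A"
    using obtains_minimal_connector[OF assms(1)] assms(3) by blast
  have "connects N E {j, k} R" using R(1) by (simp add: minimal_connectors_def)
  moreover have "A \<subseteq> N" using assms(1) by (auto simp: connects_def)
  ultimately have "connects N E {j, k} A" if "i \<notin> R"
    using R(2) that connects_mono[of N E "{j, k}" R A] by blast
  then have "i \<in> R" using assms(2) by blast
  then show ?thesis using R(1) assms by (auto simp: intermediaries_def)
qed


section \<open>The graph-restricted game\<close>

text \<open>Each \<open>v C\<close> is expanded into dividends. A non-empty \<open>T\<close> lies in
  a component of \<open>A\<close>, and then in only one, exactly when \<open>A\<close> connects
  it.\<close>

lemma restricted_game_dividend: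
  assumes "finite N" "v {} = 0" "A \<subseteq> N"
  shows "restricted_game N v E A = (\<Sum>T | T \<noteq> {} \<and> connects N E T A. dividend v T)"
proof -
  let ?K = "components A (induced E A)"
  have A: "finite A" using assms by (auto intro: finite_subset)
  have fin: "finite ?K" using A by (rule finite_components)
  have finC: "finite C" if "C \<in> ?K" for C
    using component_props(2)[OF that] A by (rule finite_subset)
  have "restricted_game N v E A = (\<Sum>C\<in>?K. v C)"
    using assms by (simp add: restricted_game_def)
  also have "\<dots> = (\<Sum>C\<in>?K. \<Sum>T\<in>Pow C - {{}}. dividend v T)"
    using finC assms by (simp add: sum_dividend_nonempty)
  \<comment> \<open>The empty set is left out because it lies in every component; the remaining
    families are disjoint.\<close>
  also have "\<dots> = (\<Sum>T\<in>(\<Union>C\<in>?K. Pow C - {{}}). dividend v T)"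
  proof (rule sum.UNION_disjoint[symmetric, OF fin])
    show "\<forall>C\<in>?K. finite (Pow C - {{}})" using finC by simp
    have "(Pow C - {{}}) \<inter> (Pow D - {{}}) = {}" if "C \<inter> D = {}" for C D :: "player set"
      using that by auto
    then show "\<forall>C\<in>?K. \<forall>D\<in>?K. C \<noteq> D \<longrightarrow> (Pow C - {{}}) \<inter> (Pow D - {{}}) = {}"
      using components_disjoint by meson
  qed
  also have "(\<Union>C\<in>?K. Pow C - {{}}) = {T. T \<noteq> {} \<and> connects N E T A}"
  proof (intro equalityI subsetI)
    fix T assume "T \<in> (\<Union>C\<in>?K. Pow C - {{}})"
    then obtain C where C: "C \<in> ?K" "T \<subseteq> C" "T \<noteq> {}" by auto
    have "connects N E T A"
    proof (rule connectsI)
      show "(i, j) \<in> connection A (induced E A)" if "i \<in> T" "j \<in> T" for i j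
        using that C(2) by (intro component_props(3)[OF C(1)]) auto
    qed (use C(2) component_props(2)[OF C(1)] assms(3) in auto)
    then show "T \<in> {T. T \<noteq> {} \<and> connects N E T A}" using C(3) by simp
  next
    fix T assume T: "T \<in> {T. T \<noteq> {} \<and> connects N E T A}"
    then obtain t where "t \<in> T" by auto
    then have "t \<in> A" using T by (auto simp: connects_def)
    then obtain C where C: "C \<in> ?K" "t \<in> C" using Union_components[of A "induced E A"] by auto
    have "T \<subseteq> C"
    proof
      fix s assume "s \<in> T"
      then have "(t, s) \<in> connection A (induced E A)"
        using T \<open>t \<in> T\<close> by (simp add: connects_def)
      then show "s \<in> C" by (rule component_props(4)[OF C])
    qed
    then show "T \<in> (\<Union>C\<in>?K. Pow C - {{}})" using C T by auto
  qed
  finally show ?thesis .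
qed

section \<open>Games additive over separated sets\<close>

text \<open>The property through which quotients are handled: restricted games have it, quotients
  inherit it, and restriction to the graph leaves a game that has it unchanged.\<close>

definition component_additive :: "player set \<Rightarrow> edges \<Rightarrow> tu_game \<Rightarrow> bool" where
  "component_additive N E w \<longleftrightarrow> w {} = 0 \<and>
     (\<forall>X Y. X \<union> Y \<subseteq> N \<and> X \<inter> Y = {} \<and> (\<forall>x\<in>X. \<forall>y\<in>Y. {x, y} \<notin> E) \<longrightarrow> w (X \<union> Y) = w X + w Y)"

lemma component_additiveD:
  assumes "component_additive N E w"
  shows "w {} = 0"
    and "X \<union> Y \<subseteq> N \<Longrightarrow> X \<inter> Y = {} \<Longrightarrow> (\<And>x y. x \<in> X \<Longrightarrow> y \<in> Y \<Longrightarrow> {x, y} \<notin> E) \<Longrightarrow>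
      w (X \<union> Y) = w X + w Y"
  using assms by (auto simp: component_additive_def)

text \<open>By \<open>connects_Un\<close> the non-empty sets connected in
  \<open>X \<union> Y\<close> are those connected in \<open>X\<close> or in \<open>Y\<close>, and
  the two kinds exclude each other because \<open>X\<close> and \<open>Y\<close> are
  disjoint.\<close>

lemma component_additive_restricted_game:
  assumes "finite N" "v {} = 0"
  shows "component_additive N E (restricted_game N v E)"
  unfolding component_additive_def
proof (intro conjI allI impI; (elim conjE)?)
  show "restricted_game N v E {} = 0"
    by (simp add: restricted_game_def components_def)
  fix X Y assume XY: "X \<union> Y \<subseteq> N" "X \<inter> Y = {}" "\<forall>x\<in>X. \<forall>y\<in>Y. {x, y} \<notin> E"
  let ?F = "\<lambda>A. {T. T \<noteq> {} \<and> connects N E T A}"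
  have "?F A \<subseteq> Pow N" for A by (auto simp: connects_def)
  then have fin: "finite (?F A)" for A
    using assms(1) by (rule finite_subset[OF _ finite_Pow_iff[THEN iffD2]])
  have "connects N E T (X \<union> Y) \<longleftrightarrow> connects N E T X \<or> connects N E T Y" if "T \<noteq> {}" for T
    using XY that by (intro connects_Un) auto
  then have "?F (X \<union> Y) = ?F X \<union> ?F Y"
    by blast
  moreover have "?F X \<inter> ?F Y = {}"
    using XY(2) unfolding connects_def by blast
  ultimately have "(\<Sum>T\<in>?F (X \<union> Y). dividend v T)
      = (\<Sum>T\<in>?F X. dividend v T) + (\<Sum>T\<in>?F Y. dividend v T)"
    using fin by (simp add: sum.union_disjoint)
  then show "restricted_game N v E (X \<union> Y) = restricted_game N v E X + restricted_game N v E Y"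
    using XY assms by (simp add: restricted_game_dividend)
qed

text \<open>No edge joins a component of \<open>A\<close> to the union of others, so additivity
  splits the components off one at a time.\<close>

lemma restricted_game_of_component_additive:
  assumes w: "component_additive N E w" and "finite N" "A \<subseteq> N"
  shows "restricted_game N w E A = w A"
proof -
  let ?K = "components A (induced E A)"
  have "w (\<Union>F) = (\<Sum>C\<in>F. w C)" if "F \<subseteq> ?K" "finite F" for F
    using that(2,1)
  proof induction
    case empty
    then show ?case using component_additiveD(1)[OF w] by simp
  next
    case (insert C F)
    have sub: "D \<subseteq> A" if "D \<in> insert C F" for D
      using component_props(2)[of D A "induced E A"] insert.prems that by blast
    have "{x, y} \<notin> E" if "x \<in> C" "y \<in> \<Union>F" for x y
    proof
      assume e: "{x, y} \<in> E"
      have "{x, y} \<in> induced E A" "y \<in> A"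
        using e sub that by (auto simp: induced_def)
      then have "y \<in> C"
        using component_closed[of C A "induced E A" x y] insert.prems that by blast
      then show False
        using that insert.prems insert.hyps components_disjoint[of C A "induced E A"] by blast
    qed
    moreover have "C \<inter> \<Union>F = {}"
      using insert.prems insert.hyps components_disjoint[of C A "induced E A"] by blast
    moreover have "C \<union> \<Union>F \<subseteq> N" using sub assms(3) by blast
    ultimately have "w (C \<union> \<Union>F) = w C + w (\<Union>F)"
      by (intro component_additiveD(2)[OF w])
    then show ?case using insert by simp
  qed
  from this[of ?K] have "w A = (\<Sum>C\<in>?K. w C)"
    using assms by (simp add: Union_components finite_components finite_subset)
  then show ?thesis using assms by (simp add: restricted_game_def)
qed

text \<open>The nodes of \<open>T\<close> reachable from \<open>a\<close> and the rest are non-empty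
  and have no edge in between, so \<open>w\<close> is additive over this split and
  \<open>dividend_additive\<close> applies.\<close>

lemma dividend_disconnected:
  assumes w: "component_additive N E w" and "finite N" "T \<subseteq> N" "\<not> connects N E T T"
  shows "dividend w T = 0"
proof -
  obtain a b where ab: "a \<in> T" "b \<in> T" "(a, b) \<notin> connection T (induced E T)"
    using assms(3,4) by (auto simp: connects_def)
  define X where "X = connection T (induced E T) `` {a}"
  have X: "X \<subseteq> T" "a \<in> X" "b \<notin> X" using ab by (auto simp: X_def connection_iff)
  have no_edge: "{x, y} \<notin> E" if "x \<in> X" "y \<in> T - X" for x y
  proof
    assume "{x, y} \<in> E"
    then have "(x, y) \<in> connection T (induced E T)"
      using that X by (auto simp: connection_iff induced_def)
    then show False using that unfolding X_def by (auto intro: connection_trans)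
  qed
  have "dividend w (X \<union> (T - X)) = 0"
  proof (rule dividend_additive)
    fix L R assume "L \<subseteq> X" "R \<subseteq> T - X"
    then show "w (L \<union> R) = w L + w R"
      using X no_edge assms(3) by (intro component_additiveD(2)[OF w]) blast+
  qed (use X ab assms in \<open>auto intro: finite_subset\<close>)
  moreover have "X \<union> (T - X) = T" using X by auto
  ultimately show ?thesis by simp
qed


section \<open>The Myerson interaction index satisfies the axioms\<close>

lemma finite_player_set: "N \<in> player_sets \<Longrightarrow> finite N"
  by (simp add: player_sets_def)

lemma player_set_subset: "N \<in> player_sets \<Longrightarrow> C \<subseteq> N \<Longrightarrow> C \<noteq> {} \<Longrightarrow> C \<in> player_sets"
  by (auto simp: player_sets_def intro: finite_subset)

lemma game_empty: "v \<in> games N \<Longrightarrow> v {} = 0"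
  by (simp add: games_def)

lemma subgame_in_games: "v \<in> games N \<Longrightarrow> subgame v C \<in> games C"
  by (simp add: games_def subgame_def)

lemma restricted_game_component:
  assumes "C \<subseteq> N" "A \<subseteq> C"
  shows "restricted_game C (subgame v C) (induced E C) A = restricted_game N v E A"
proof -
  have "subgame v C D = v D" if "D \<in> components A (induced E A)" for D
    using component_props(2)[OF that] assms by (auto simp: subgame_def)
  moreover have "A \<subseteq> N" using assms by simp
  ultimately show ?thesis
    using assms by (simp add: restricted_game_def induced_induced)
qed

lemma restricted_game_in_games: "restricted_game N v E \<in> games N"
  by (simp add: games_def restricted_game_def components_def)

lemma restricted_game_connected:
  "connects N E A A \<Longrightarrow> A \<noteq> {} \<Longrightarrow> restricted_game N v E A = v A"
  using components_connected[of N E A] by (simp add: restricted_game_def connects_def)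

lemma dividend_restricted_game_disconnected:
  assumes "N \<in> player_sets" "v \<in> games N" "T \<subseteq> N" "\<not> connects N E T T"
  shows "dividend (restricted_game N v E) T = 0"
  by (rule dividend_disconnected[OF component_additive_restricted_game])
    (use assms in \<open>auto simp: finite_player_set game_empty\<close>)

section \<open>Locality and efficiency of \<open>MI\<close>\<close>

text \<open>Terms of \<open>SI_dividend\<close> with \<open>S \<union> T\<close> disconnected
  vanish, and a connected \<open>S \<union> T\<close> lies in one component. So nothing remains if
  no component contains \<open>S\<close>, and only \<open>T \<subseteq> C\<close> remains if
  \<open>S \<subseteq> C\<close>.\<close>

lemma graph_interaction_index_MI: "graph_interaction_index MI"
  unfolding graph_interaction_index_def
proof (intro ballI allI impI conjI; (elim conjE)?)
  fix N v E S
  assume N: "N \<in> player_sets" and v: "v \<in> games N" and E: "E \<in> graphs N"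
    and S: "S \<noteq> {}" "S \<subseteq> N"
  note fin = finite_player_set[OF N]
  let ?w = "restricted_game N v E"
  {
    assume sep: "\<forall>C\<in>components N E. \<not> S \<subseteq> C"
    have "dividend ?w (S \<union> T) = 0" if "T \<in> Pow (N - S)" for T
    proof -
      have "\<not> connects N E (S \<union> T) (S \<union> T)"
      proof
        assume con: "connects N E (S \<union> T) (S \<union> T)"
        obtain s where "s \<in> S" using S by auto
        then obtain C where "C \<in> components N E" "s \<in> C"
          using S Union_components[of N E] by auto
        then show False
          using connects_subset_component[OF con] sep \<open>s \<in> S\<close> by auto
      qed
      then show ?thesis
        using that S by (intro dividend_restricted_game_disconnected[OF N v]) auto
    qed
    then show "MI N v E S = 0"
      unfolding MI_def SI_dividend[OF fin S(2)] by simp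
  next
    fix C assume C: "C \<in> components N E" "S \<subseteq> C"
    note CN = component_props(2)[OF C(1)]
    let ?u = "restricted_game C (subgame v C) (induced E C)"
    have "MI N v E S = (\<Sum>T\<in>Pow (N - S). dividend ?w (S \<union> T) / (real (card T) + 1))"
      unfolding MI_def by (rule SI_dividend[OF fin S(2)])
    also have "\<dots> = (\<Sum>T\<in>Pow (C - S). dividend ?w (S \<union> T) / (real (card T) + 1))"
    proof (rule sum.mono_neutral_right)
      show "\<forall>T\<in>Pow (N - S) - Pow (C - S). dividend ?w (S \<union> T) / (real (card T) + 1) = 0"
      proof
        fix T assume T: "T \<in> Pow (N - S) - Pow (C - S)"
        have "\<not> connects N E (S \<union> T) (S \<union> T)"
        proof
          assume "connects N E (S \<union> T) (S \<union> T)"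
          then have "S \<union> T \<subseteq> C"
            using C S by (intro connects_subset_component) auto
          then show False using T by auto
        qed
        then show "dividend ?w (S \<union> T) / (real (card T) + 1) = 0"
          using T S dividend_restricted_game_disconnected[OF N v, of "S \<union> T"] by auto
      qed
    qed (use fin CN in auto)
    also have "\<dots> = (\<Sum>T\<in>Pow (C - S). dividend ?u (S \<union> T) / (real (card T) + 1))"
    proof (intro sum.cong refl)
      fix T assume "T \<in> Pow (C - S)"
      then have "dividend ?w (S \<union> T) = dividend ?u (S \<union> T)"
        using C by (intro dividend_cong restricted_game_component[OF CN, symmetric]) auto
      then show "dividend ?w (S \<union> T) / (real (card T) + 1) = dividend ?u (S \<union> T) / (real (card T) + 1)"
        by simp
    qed
    also have "\<dots> = MI C (subgame v C) (induced E C) S"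
      unfolding MI_def using C(2) fin CN by (intro SI_dividend[symmetric]) (auto intro: finite_subset)
    finally show "MI N v E S = MI C (subgame v C) (induced E C) S" .
  }
qed

text \<open>Locality moves the sum to \<open>C\<close>, where Shapley efficiency gives the
  restricted worth of \<open>C\<close>; this is \<open>v C\<close> since \<open>C\<close> is
  connected.\<close>

lemma component_efficiency_MI: "component_efficiency MI"
  unfolding component_efficiency_def
proof (intro ballI)
  fix N v E C
  assume N: "N \<in> player_sets" and v: "v \<in> games N" and E: "E \<in> graphs N"
    and C: "C \<in> components N E"
  note CN = component_props(1,2)[OF C]
  let ?u = "restricted_game C (subgame v C) (induced E C)"
  have "(\<Sum>i\<in>C. MI N v E {i}) = (\<Sum>i\<in>C. SI C ?u {i})"
  proof (intro sum.cong refl)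
    fix i assume "i \<in> C"
    then have "{i} \<noteq> {}" "{i} \<subseteq> N" "{i} \<subseteq> C" using CN by auto
    then have "MI N v E {i} = MI C (subgame v C) (induced E C) {i}"
      using graph_interaction_index_MI N v E C unfolding graph_interaction_index_def by meson
    then show "MI N v E {i} = SI C ?u {i}" by (simp add: MI_def)
  qed
  also have "\<dots> = ?u C"
    using finite_player_set[OF N] CN
    by (intro SI_efficient) (auto intro: finite_subset game_empty[OF restricted_game_in_games])
  also have "\<dots> = v C"
    using CN connects_component[OF E C]
    by (simp add: restricted_game_component restricted_game_connected)
  finally show "(\<Sum>i\<in>C. MI N v E {i}) = v C" .
qed

section \<open>Fairness and linearity of \<open>MI\<close>\<close>

text \<open>Removing the edge changes the restricted game only on sets that contain both
  \<open>i\<close> and \<open>j\<close>. The difference of the indices is thus a sum over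
  \<open>U \<supseteq> S \<union> {i, j}\<close> whose weights depend on \<open>card U\<close> and
  \<open>card S\<close> alone, the same for both ends of the edge.\<close>

lemma fairness_MI: "fairness MI"
  unfolding fairness_def
proof (intro ballI allI impI)
  fix N v E i j S
  assume N: "N \<in> player_sets" and v: "v \<in> games N" and E: "E \<in> graphs N"
    and ij: "{i, j} \<in> E" and S: "S \<subseteq> N - {i, j}"
  note fin = finite_player_set[OF N]
  have ijN: "i \<in> N" "j \<in> N" "i \<noteq> j"
    using graph_edge[OF E ij] by (metis doubleton_eq_iff)+
  have finS: "finite S" using S fin by (auto intro: finite_subset)
  let ?E = "E - {{i, j}}"
  let ?w = "restricted_game N v E" and ?w' = "restricted_game N v ?E"
  have same: "dividend ?w U = dividend ?w' U" if "\<not> {i, j} \<subseteq> U" "U \<subseteq> N" for U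
  proof (rule dividend_cong)
    fix A assume "A \<subseteq> U"
    then have "induced ?E A = induced E A" "A \<subseteq> N" using that by (auto simp: induced_def)
    then show "?w A = ?w' A" by (simp add: restricted_game_def)
  qed
  have diff: "MI N v E (insert a S) - MI N v ?E (insert a S)
      = (\<Sum>U | insert i (insert j S) \<subseteq> U \<and> U \<subseteq> N.
          (dividend ?w U - dividend ?w' U) / (real (card U - Suc (card S)) + 1))"
    if a: "a \<in> {i, j}" for a
  proof -
    have aS: "a \<notin> S" "insert a S \<subseteq> N" using a S ijN by auto
    have "MI N v E (insert a S) - MI N v ?E (insert a S)
      = (\<Sum>U | insert a S \<subseteq> U \<and> U \<subseteq> N.
          (dividend ?w U - dividend ?w' U) / (real (card (U - insert a S)) + 1))"
      unfolding MI_def SI_dividend_superset[OF fin aS(2)]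
      by (simp add: sum_subtractf diff_divide_distrib)
    also have "\<dots> = (\<Sum>U | insert a S \<subseteq> U \<and> U \<subseteq> N.
          (dividend ?w U - dividend ?w' U) / (real (card U - Suc (card S)) + 1))"
      using finS aS by (intro sum.cong refl) (simp add: card_Diff_subset)
    also have "\<dots> = (\<Sum>U | insert i (insert j S) \<subseteq> U \<and> U \<subseteq> N.
          (dividend ?w U - dividend ?w' U) / (real (card U - Suc (card S)) + 1))"
    proof (rule sum.mono_neutral_right)
      show "finite {U. insert a S \<subseteq> U \<and> U \<subseteq> N}"
        using fin by (auto intro: finite_subset[of _ "Pow N"])
      show "{U. insert i (insert j S) \<subseteq> U \<and> U \<subseteq> N} \<subseteq> {U. insert a S \<subseteq> U \<and> U \<subseteq> N}"
        using a by auto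
      show "\<forall>U\<in>{U. insert a S \<subseteq> U \<and> U \<subseteq> N} - {U. insert i (insert j S) \<subseteq> U \<and> U \<subseteq> N}.
          (dividend ?w U - dividend ?w' U) / (real (card U - Suc (card S)) + 1) = 0"
        using same by auto
    qed
    finally show ?thesis .
  qed
  show "MI N v E (insert i S) - MI N v ?E (insert i S)
      = MI N v E (insert j S) - MI N v ?E (insert j S)"
    using diff[of i] diff[of j] by simp
qed

lemma linearity_MI: "linearity MI"
  unfolding linearity_def
proof (intro ballI allI impI, elim conjE)
  fix N v\<^sub>1 v\<^sub>2 E S and \<alpha>\<^sub>1 \<alpha>\<^sub>2 :: real
  assume N: "N \<in> player_sets" and S: "S \<subseteq> N"
  let ?w = "restricted_game N (lin_comb N \<alpha>\<^sub>1 v\<^sub>1 \<alpha>\<^sub>2 v\<^sub>2) E"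
    and ?w\<^sub>1 = "restricted_game N v\<^sub>1 E" and ?w\<^sub>2 = "restricted_game N v\<^sub>2 E"
  have w: "?w A = \<alpha>\<^sub>1 * ?w\<^sub>1 A + \<alpha>\<^sub>2 * ?w\<^sub>2 A" if A: "A \<subseteq> N" for A
  proof -
    have "lin_comb N \<alpha>\<^sub>1 v\<^sub>1 \<alpha>\<^sub>2 v\<^sub>2 C = \<alpha>\<^sub>1 * v\<^sub>1 C + \<alpha>\<^sub>2 * v\<^sub>2 C"
      if "C \<in> components A (induced E A)" for C
      using component_props(2)[OF that] A by (auto simp: lin_comb_def)
    then show ?thesis
      using A by (simp add: restricted_game_def sum.distrib sum_distrib_left)
  qed
  have div: "dividend ?w U = \<alpha>\<^sub>1 * dividend ?w\<^sub>1 U + \<alpha>\<^sub>2 * dividend ?w\<^sub>2 U" if "U \<subseteq> N" for U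
  proof -
    have "dividend ?w U = dividend (\<lambda>A. \<alpha>\<^sub>1 * ?w\<^sub>1 A + \<alpha>\<^sub>2 * ?w\<^sub>2 A) U"
      using that by (intro dividend_cong w) auto
    also have "\<dots> = \<alpha>\<^sub>1 * dividend ?w\<^sub>1 U + \<alpha>\<^sub>2 * dividend ?w\<^sub>2 U"
      unfolding dividend_def sum_distrib_left sum.distrib [symmetric]
      by (simp add: algebra_simps)
    finally show ?thesis .
  qed
  have "dividend ?w (S \<union> T) / (real (card T) + 1)
      = \<alpha>\<^sub>1 * (dividend ?w\<^sub>1 (S \<union> T) / (real (card T) + 1))
      + \<alpha>\<^sub>2 * (dividend ?w\<^sub>2 (S \<union> T) / (real (card T) + 1))" if "T \<in> Pow (N - S)" for T
  proof -
    have "S \<union> T \<subseteq> N" using that S by auto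
    then show ?thesis by (simp add: div add_divide_distrib)
  qed
  then show "MI N (lin_comb N \<alpha>\<^sub>1 v\<^sub>1 \<alpha>\<^sub>2 v\<^sub>2) E S = \<alpha>\<^sub>1 * MI N v\<^sub>1 E S + \<alpha>\<^sub>2 * MI N v\<^sub>2 E S"
    unfolding MI_def SI_dividend[OF finite_player_set[OF N] S] sum_distrib_left
      sum.distrib [symmetric]
    by (intro sum.cong refl)
qed

section \<open>Graph null players\<close>

lemma dividend_null_player:
  assumes "null_player N v i" "finite T" "T \<subseteq> N" "i \<in> T"
  shows "dividend v T = 0"
proof -
  have "v (insert i L) - v L = 0" if "L \<subseteq> T - {i}" for L
  proof -
    have "L \<subseteq> N - {i}" using that assms(3) by auto
    then show ?thesis using assms(1) by (simp add: null_player_def)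
  qed
  then have "dividend v (insert i (T - {i})) = 0"
    using assms(2) by (simp add: dividend_insert dividend_zero del: insert_Diff_single)
  then show ?thesis using assms(4) by (simp add: insert_absorb)
qed

text \<open>Adding \<open>i\<close> to \<open>L\<close> adds the dividends of the sets
  \<open>T\<close> that become connected. If one is non-zero, \<open>T\<close> has no null member;
  then \<open>i\<close> is outside \<open>T\<close> and mediates between two members of
  \<open>T\<close>, one of which must be null, a contradiction.\<close>

lemma restricted_game_graph_null_player:
  assumes "finite N" "v {} = 0" and null: "graph_null_player_conn N v E i" and L: "L \<subseteq> N - {i}"
  shows "restricted_game N v E (insert i L) = restricted_game N v E L"
proof -
  have i: "null_player N v i" "i \<in> N"
    using null by (simp_all add: graph_null_player_conn_def null_player_def)
  let ?F = "\<lambda>A. {T. T \<noteq> {} \<and> connects N E T A}"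
  have "(\<Sum>T\<in>?F (insert i L). dividend v T) = (\<Sum>T\<in>?F L. dividend v T)"
  proof (rule sum.mono_neutral_right)
    have "?F (insert i L) \<subseteq> Pow N" by (auto simp: connects_def)
    then show "finite (?F (insert i L))"
      using assms(1) by (simp add: finite_subset)
    show "?F L \<subseteq> ?F (insert i L)"
    proof
      fix T assume "T \<in> ?F L"
      moreover have "insert i L \<subseteq> N" using L i by auto
      ultimately show "T \<in> ?F (insert i L)"
        using connects_mono[of N E T L "insert i L"] by auto
    qed
    show "\<forall>T\<in>?F (insert i L) - ?F L. dividend v T = 0"
    proof (rule ballI, rule ccontr)
      fix T assume T: "T \<in> ?F (insert i L) - ?F L" and nz: "dividend v T \<noteq> 0"
      then have con: "connects N E T (insert i L)" by simp
      then have TN: "T \<subseteq> N" by (auto simp: connects_def)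
      then have finT: "finite T" using assms(1) by (rule finite_subset)
      have no_null: "\<not> null_player N v k" if "k \<in> T" for k
        using dividend_null_player[OF _ finT TN that] nz by blast
      then have "i \<notin> T" using i by blast
      then have "T \<subseteq> L" using con by (auto simp: connects_def)
      moreover have "\<not> connects N E T L" using T by auto
      ultimately obtain j k where jk: "j \<in> T" "k \<in> T" "(j, k) \<notin> connection L (induced E L)"
        using L by (auto simp: connects_def)
      have "(j, j) \<in> connection L (induced E L)"
        using \<open>T \<subseteq> L\<close> jk(1) by (auto simp: connection_iff)
      then have "j \<noteq> k" using jk(3) by blast
      have "i \<in> intermediaries N E {j, k}"
      proof (rule intermediary_of_cut)
        show "connects N E {j, k} (insert i L)"
          using jk(1,2) by (intro connects_antimono[OF con]) auto
        show "\<not> connects N E {j, k} L"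
          using jk by (simp add: connects_def)
        show "finite L" using L assms(1) by (auto intro: finite_subset)
        show "i \<noteq> j" "i \<noteq> k" using jk(1,2) \<open>i \<notin> T\<close> by auto
      qed
      moreover have "j \<in> N - {i}" "k \<in> N - {i}" using jk TN \<open>i \<notin> T\<close> by auto
      ultimately have "null_player N v j \<or> null_player N v k"
        using null \<open>j \<noteq> k\<close> by (simp add: graph_null_player_conn_def)
      then show False using no_null jk by blast
    qed
  qed
  moreover have "insert i L \<subseteq> N" "L \<subseteq> N" using L i by auto
  ultimately show ?thesis
    by (simp only: restricted_game_dividend[of N v, OF assms(1,2)])
qed

text \<open>A connected \<open>insert i S \<union> T\<close> lies in the component of
  \<open>i\<close>, where \<open>i\<close> is null in the restricted game; for disconnected ones the
  dividend vanishes anyway.\<close>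

lemma graph_null_MI: "graph_null MI"
  unfolding graph_null_def
proof (intro ballI allI impI)
  fix N v E i S
  assume N: "N \<in> player_sets" and v: "v \<in> games N" and E: "E \<in> graphs N"
    and null: "graph_null_player N v E i" and S: "S \<subseteq> N - {i}"
  note fin = finite_player_set[OF N]
  obtain C where C: "C \<in> components N E"
    and iC: "graph_null_player_conn C (subgame v C) (induced E C) i"
    using null by (auto simp: graph_null_player_def)
  note CN = component_props(2)[OF C]
  have finC: "finite C" and u0: "subgame v C {} = 0"
    using finite_subset[OF CN fin] game_empty[OF subgame_in_games[OF v]] by auto
  have i: "i \<in> C" using iC by (simp add: graph_null_player_conn_def null_player_def)
  let ?w = "restricted_game N v E"
  have marginal: "?w (insert i L) = ?w L" if "L \<subseteq> C - {i}" for L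
  proof -
    have "restricted_game C (subgame v C) (induced E C) (insert i L)
        = restricted_game C (subgame v C) (induced E C) L"
      by (rule restricted_game_graph_null_player[OF finC u0 iC that])
    moreover have "insert i L \<subseteq> C" "L \<subseteq> C" using that i by auto
    ultimately show ?thesis
      by (simp only: restricted_game_component[OF CN])
  qed
  have "dividend ?w (insert i S \<union> T) = 0" if T: "T \<in> Pow (N - insert i S)" for T
  proof (cases "connects N E (insert i S \<union> T) (insert i S \<union> T)")
    case True
    then have sub: "insert i (S \<union> T) \<subseteq> C"
      using connects_subset_component[OF _ C] i by auto
    have "S \<union> T \<subseteq> N" "i \<notin> S \<union> T" using T S by auto
    then have ST: "finite (S \<union> T)" "i \<notin> S \<union> T" using fin finite_subset by auto
    have "?w (insert i L) - ?w L = 0" if "L \<subseteq> S \<union> T" for L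
      using marginal[of L] that ST(2) sub by auto
    then show ?thesis
      using ST by (simp add: dividend_insert dividend_zero)
  next
    case False
    then show ?thesis
      using T S i CN by (intro dividend_restricted_game_disconnected[OF N v]) auto
  qed
  moreover have "insert i S \<subseteq> N" using S i CN by auto
  ultimately show "MI N v E (insert i S) = 0"
    unfolding MI_def by (simp add: SI_dividend[OF fin])
qed

section \<open>Veto graph partnerships and quotients\<close>

lemma veto_partnership_zero:
  assumes "veto_partnership N v V" "A \<subseteq> N" "\<not> V \<subseteq> A"
  shows "v A = 0"
proof -
  have "A - V \<subseteq> N - V" "A \<inter> V \<subset> V" using assms by auto
  then have "v ((A - V) \<union> (A \<inter> V)) = 0"
    using assms(1) unfolding veto_partnership_def by simp
  then show ?thesis by (simp add: Un_Diff_Int)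
qed

text \<open>If \<open>A\<close> connects some \<open>T \<supseteq> V\<close>, it contains a minimal
  connector of \<open>V\<close>, hence \<open>V\<close> with its essential intermediaries, hence
  \<open>P\<close>. So every \<open>T\<close> connected in \<open>A\<close> misses part of
  \<open>V\<close> and has dividend zero.\<close>

lemma restricted_game_veto_graph_partnership:
  assumes "finite N" "v {} = 0" and veto: "veto_graph_partnership_conn N v E P"
    and A: "A \<subseteq> N" "\<not> P \<subseteq> A"
  shows "restricted_game N v E A = 0"
proof -
  obtain V where V: "veto_partnership N v V" and P: "P \<subseteq> V \<union> essential_intermediaries N E V"
    using veto by (auto simp: veto_graph_partnership_conn_def)
  have "dividend v T = 0" if T: "connects N E T A" for T
  proof -
    have "\<not> V \<subseteq> T"
    proof
      assume "V \<subseteq> T"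
      with T have "connects N E V A" by (rule connects_antimono)
      then obtain R where R: "R \<in> minimal_connectors N E V" "R \<subseteq> A"
        using finite_subset[OF A(1) assms(1)] by (rule obtains_minimal_connector)
      have "V \<subseteq> R" using R(1) by (simp add: minimal_connectors_def connects_def)
      moreover have "essential_intermediaries N E V \<subseteq> R"
        using R(1) by (auto simp: essential_intermediaries_def)
      ultimately show False using P R(2) A(2) by blast
    qed
    then show ?thesis
      using T A by (intro dividend_zero veto_partnership_zero[OF V]) (auto simp: connects_def)
  qed
  then show ?thesis
    using assms(1,2) A by (simp add: restricted_game_dividend)
qed

lemma quotient_game_in_games:
  assumes "v \<in> games N"
  shows "quotient_game N v C p \<in> games (quotient_players N C p)"
  using assms by (simp add: games_def quotient_game_def)

lemma quotient_graph_in_graphs: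
  assumes "E \<in> graphs N" "p \<notin> N - C"
  shows "quotient_graph N E C p \<in> graphs (quotient_players N C p)"
proof -
  have "\<exists>i j. e = {i, j} \<and> i \<in> insert p (N - C) \<and> j \<in> insert p (N - C) \<and> i \<noteq> j"
    if "e \<in> quotient_graph N E C p" for e
  proof -
    from that consider "e \<in> induced E (N - C)" | j where "e = {p, j}" "j \<in> N - C"
      by (auto simp: quotient_graph_def)
    then show ?thesis
    proof cases
      case 1
      then show ?thesis
        by (rule graph_edge[OF induced_in_graphs[OF assms(1)]]) blast
    next
      case 2
      then show ?thesis using assms(2) by blast
    qed
  qed
  then show ?thesis by (auto simp: graphs_def quotient_players_def)
qed

text \<open>Put \<open>P\<close> back in place of \<open>p\<close>: an edge of \<open>E\<close>
  between the two sides would be an edge of the quotient graph between the original sides. Separated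
  sets thus stay separated, and \<open>w\<close> is additive over them.\<close>

lemma component_additive_quotient:
  assumes w: "component_additive N E w" and P: "P \<subseteq> N" "p \<notin> N - P"
  shows "component_additive (quotient_players N P p) (quotient_graph N E P p) (quotient_game N w P p)"
proof -
  let ?q = "quotient_game N w P p" and ?N = "insert p (N - P)" and ?E = "quotient_graph N E P p"
  have q: "?q A = (if p \<in> A then w ((A - {p}) \<union> P) else w A)" if "A \<subseteq> ?N" for A
    using that by (simp add: quotient_game_def quotient_players_def)
  \<comment> \<open>The case of \<open>p\<close> in the left set also settles that of
    \<open>p\<close> in the right set, by symmetry.\<close>
  have proxy_left: "?q (X \<union> Y) = ?q X + ?q Y"
    if XY: "X \<union> Y \<subseteq> ?N" "X \<inter> Y = {}" and e: "\<And>x y. x \<in> X \<Longrightarrow> y \<in> Y \<Longrightarrow> {x, y} \<notin> ?E"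
      and p: "p \<in> X" for X Y
  proof -
    have Y: "p \<notin> Y" "Y \<subseteq> N - P" using XY p by auto
    have "w (((X - {p}) \<union> P) \<union> Y) = w ((X - {p}) \<union> P) + w Y"
    proof (rule component_additiveD(2)[OF w])
      fix x y assume x: "x \<in> X - {p} \<union> P" and y: "y \<in> Y"
      show "{x, y} \<notin> E"
      proof
        assume xy: "{x, y} \<in> E"
        show False
        proof (cases "x \<in> P")
          case True
          then have "{p, y} \<in> ?E" using xy y Y by (auto simp: quotient_graph_def)
          then show False using e p y by blast
        next
          case False
          then have "x \<in> X" "x \<in> N - P" using x XY by auto
          then have "{x, y} \<in> ?E" using xy y Y by (auto simp: quotient_graph_def induced_def)
          then show False using e \<open>x \<in> X\<close> y by blast
        qed
      qed
    qed (use XY Y P in auto)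
    moreover have "(X \<union> Y) - {p} \<union> P = ((X - {p}) \<union> P) \<union> Y" using Y by auto
    ultimately show ?thesis using XY p Y by (simp add: q)
  qed
  have "?q (X \<union> Y) = ?q X + ?q Y"
    if XY: "X \<union> Y \<subseteq> ?N" "X \<inter> Y = {}" and e: "\<And>x y. x \<in> X \<Longrightarrow> y \<in> Y \<Longrightarrow> {x, y} \<notin> ?E" for X Y
  proof -
    consider "p \<in> X" | "p \<in> Y" | "p \<notin> X" "p \<notin> Y" by blast
    then show ?thesis
    proof cases
      case 1
      show ?thesis by (rule proxy_left[OF XY e 1])
    next
      case 2
      have "{x, y} \<notin> ?E" if "x \<in> Y" "y \<in> X" for x y
        using e[OF that(2,1)] by (simp add: insert_commute)
      then have "?q (Y \<union> X) = ?q Y + ?q X"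
        using XY 2 by (intro proxy_left) auto
      then show ?thesis by (simp add: Un_commute)
    next
      case 3
      then have sub: "X \<subseteq> N - P" "Y \<subseteq> N - P" using XY by auto
      have "w (X \<union> Y) = w X + w Y"
      proof (rule component_additiveD(2)[OF w])
        show "{x, y} \<notin> E" if "x \<in> X" "y \<in> Y" for x y
          using e[OF that] that sub by (auto simp: quotient_graph_def induced_def)
      qed (use sub XY in auto)
      then show ?thesis using XY 3 by (simp add: q)
    qed
  qed
  moreover have "?q {} = 0" using q[of "{}"] component_additiveD(1)[OF w] by simp
  ultimately show ?thesis
    by (simp add: component_additive_def quotient_players_def)
qed

text \<open>The difference in \<open>p\<close> compares all of \<open>P\<close> with none of it;
  Moebius inversion over \<open>P\<close> spreads it over the non-empty
  \<open>R \<subseteq> P\<close>.\<close>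

lemma dividend_quotient_game:
  assumes "finite N" "P \<subseteq> N" "p \<notin> N - P" "T \<subseteq> N - P"
  shows "dividend (quotient_game N w P p) (insert p T) = (\<Sum>R\<in>Pow P - {{}}. dividend w (T \<union> R))"
proof -
  let ?q = "quotient_game N w P p"
  let ?D = "\<lambda>R. dividend (\<lambda>L. w (L \<union> R)) T"
  have fin: "finite T" "finite P" using assms by (auto intro: finite_subset)
  have "dividend ?q (insert p T) = dividend (\<lambda>L. ?q (insert p L) - ?q L) T"
    using assms fin by (intro dividend_insert) auto
  also have "\<dots> = dividend (\<lambda>L. w (L \<union> P) - w (L \<union> {})) T"
  proof (rule dividend_cong)
    fix L assume "L \<subseteq> T"
    \<comment> \<open>The proxy may belong to \<open>P\<close>, but never to \<open>N - P\<close>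
      and hence not to \<open>L\<close>.\<close>
    then have "L \<subseteq> N - P" "p \<notin> L" using assms by auto
    then show "?q (insert p L) - ?q L = w (L \<union> P) - w (L \<union> {})"
      by (auto simp: quotient_game_def quotient_players_def)
  qed
  also have "\<dots> = ?D P - ?D {}" by (rule dividend_diff)
  also have "\<dots> = (\<Sum>R\<in>Pow P - {{}}. dividend ?D R)"
    using fin sum_dividend[of P ?D] by (simp add: sum_diff1)
  also have "\<dots> = (\<Sum>R\<in>Pow P - {{}}. dividend w (T \<union> R))"
  proof (intro sum.cong refl)
    fix R assume "R \<in> Pow P - {{}}"
    then have "finite R" "T \<inter> R = {}" using fin assms by (auto intro: finite_subset)
    then show "dividend ?D R = dividend w (T \<union> R)" using fin by (simp add: dividend_Un)
  qed
  finally show ?thesis .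
qed

lemma proxy_choiceD:
  assumes "proxy_choice proxy" "N \<in> player_sets" "P \<noteq> {}" "P \<subseteq> N"
  shows "proxy N P \<notin> N - P" "quotient_players N P (proxy N P) \<in> player_sets"
  using assms by (auto simp: proxy_choice_def player_sets_def quotient_players_def)

text \<open>Restricting the quotient game again has no effect, as it is additive over separated
  sets. Of the sum in \<open>dividend_quotient_game\<close> only \<open>R = P\<close> survives the
  veto, so the two indices agree term by term.\<close>

lemma strong_reduced_veto_partnership_consistency_MI:
  assumes "proxy_choice proxy"
  shows "strong_reduced_veto_partnership_consistency proxy MI"
  unfolding strong_reduced_veto_partnership_consistency_def Let_def
proof (intro ballI allI impI)
  fix N v E P S
  assume N: "N \<in> player_sets" and v: "v \<in> games N" and E: "E \<in> graphs N"
    and veto: "veto_graph_partnership N v E P" and S: "S \<subseteq> N - P"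
  note fin = finite_player_set[OF N]
  obtain C where C: "C \<in> components N E"
    and vetoC: "veto_graph_partnership_conn C (subgame v C) (induced E C) P"
    using veto by (auto simp: veto_graph_partnership_def)
  note CN = component_props(2)[OF C]
  have finC: "finite C" and u0: "subgame v C {} = 0"
    using finite_subset[OF CN fin] game_empty[OF subgame_in_games[OF v]] by auto
  have P: "P \<noteq> {}" "P \<subseteq> C" "P \<subseteq> N"
    using vetoC CN by (auto simp: veto_graph_partnership_conn_def)
  let ?p = "proxy N P"
  let ?N = "quotient_players N P ?p"
  let ?w = "restricted_game N v E"
  let ?q = "quotient_game N ?w P ?p"
  note p = proxy_choiceD[OF assms N P(1,3)]
  have w: "component_additive N E ?w"
    by (rule component_additive_restricted_game) (use fin game_empty[OF v] in auto)
  \<comment> \<open>For \<open>T \<subseteq> C\<close> no subset of \<open>T \<union> R\<close>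
    contains \<open>P\<close>, so the restricted game vanishes on all of them. Otherwise
    \<open>T \<union> R\<close> meets \<open>C\<close> in \<open>R\<close> without lying in it and
    is disconnected.\<close>
  have zero: "dividend ?w (T \<union> R) = 0" if "T \<subseteq> N - P" "R \<subset> P" "R \<noteq> {}" for T R
  proof (cases "T \<subseteq> C")
    case True
    show ?thesis
    proof (rule dividend_zero)
      fix A assume "A \<subseteq> T \<union> R"
      then have A: "A \<subseteq> C" "\<not> P \<subseteq> A" using that P True by blast+
      have "restricted_game C (subgame v C) (induced E C) A = 0"
        by (rule restricted_game_veto_graph_partnership[OF finC u0 vetoC A])
      then show "?w A = 0" using A by (simp add: restricted_game_component[OF CN])
    qed
  next
    case False
    have "\<not> connects N E (T \<union> R) (T \<union> R)"
    proof
      assume "connects N E (T \<union> R) (T \<union> R)"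
      then have "T \<union> R \<subseteq> C" using that P by (intro connects_subset_component[OF _ C]) auto
      then show False using False by auto
    qed
    then show ?thesis
      using that P by (intro dividend_restricted_game_disconnected[OF N v]) auto
  qed
  have quot: "dividend ?q (insert ?p T) = dividend ?w (T \<union> P)" if T: "T \<subseteq> N - P" for T
  proof -
    have "dividend ?q (insert ?p T) = (\<Sum>R\<in>Pow P - {{}}. dividend ?w (T \<union> R))"
      by (rule dividend_quotient_game[OF fin P(3) p(1) T])
    also have "\<dots> = (\<Sum>R\<in>{P}. dividend ?w (T \<union> R))"
    proof (rule sum.mono_neutral_right)
      show "\<forall>R\<in>Pow P - {{}} - {P}. dividend ?w (T \<union> R) = 0"
        using zero[OF T] by blast
    qed (use P fin in \<open>auto intro: finite_subset\<close>)
    finally show ?thesis by simp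
  qed
  have S': "insert ?p S \<subseteq> ?N" using S by (auto simp: quotient_players_def)
  have finN': "finite ?N" using fin by (simp add: quotient_players_def)
  have "MI ?N ?q (quotient_graph N E P ?p) (insert ?p S)
      = (\<Sum>T\<in>Pow (?N - insert ?p S).
          dividend (restricted_game ?N ?q (quotient_graph N E P ?p)) (insert ?p S \<union> T) / (real (card T) + 1))"
    unfolding MI_def by (rule SI_dividend[OF finN' S'])
  \<comment> \<open>The players outside the coalition are the same before and after merging, so both
    sums have the same range and weights.\<close>
  also have "?N - insert ?p S = N - (P \<union> S)"
    using p(1) S by (auto simp: quotient_players_def)
  also have "(\<Sum>T\<in>Pow (N - (P \<union> S)).
        dividend (restricted_game ?N ?q (quotient_graph N E P ?p)) (insert ?p S \<union> T) / (real (card T) + 1))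
      = (\<Sum>T\<in>Pow (N - (P \<union> S)). dividend ?w (P \<union> S \<union> T) / (real (card T) + 1))"
  proof (intro sum.cong refl)
    fix T assume T: "T \<in> Pow (N - (P \<union> S))"
    have "dividend (restricted_game ?N ?q (quotient_graph N E P ?p)) (insert ?p S \<union> T)
        = dividend ?q (insert ?p S \<union> T)"
    proof (rule dividend_cong)
      fix A assume "A \<subseteq> insert ?p S \<union> T"
      then have "A \<subseteq> ?N" using T S by (auto simp: quotient_players_def)
      then show "restricted_game ?N ?q (quotient_graph N E P ?p) A = ?q A"
        by (rule restricted_game_of_component_additive[OF
              component_additive_quotient[OF w P(3) p(1)] finN'])
    qed
    also have "\<dots> = dividend ?w (P \<union> S \<union> T)"
    proof -
      have "S \<union> T \<subseteq> N - P" using T S by auto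
      then show ?thesis using quot[of "S \<union> T"] by (simp add: Un_ac)
    qed
    finally show "dividend (restricted_game ?N ?q (quotient_graph N E P ?p)) (insert ?p S \<union> T)
          / (real (card T) + 1) = dividend ?w (P \<union> S \<union> T) / (real (card T) + 1)"
      by simp
  qed
  also have "\<dots> = MI N v E (P \<union> S)"
    unfolding MI_def using P S by (intro SI_dividend[OF fin, symmetric]) auto
  finally show "MI N v E (P \<union> S)
      = MI ?N ?q (quotient_graph N E P ?p) (insert ?p S)" by simp
qed


section \<open>Uniqueness\<close>

definition unanimity_game :: "player set \<Rightarrow> player set \<Rightarrow> tu_game" where
  "unanimity_game N T = (\<lambda>A\<in>Pow N. if T \<subseteq> A then 1 else 0)"

lemma unanimity_game_in_games: "T \<noteq> {} \<Longrightarrow> unanimity_game N T \<in> games N"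
  by (auto simp: games_def unanimity_game_def)

lemma linearityD:
  "linearity I \<Longrightarrow> N \<in> player_sets \<Longrightarrow> v\<^sub>1 \<in> games N \<Longrightarrow> v\<^sub>2 \<in> games N \<Longrightarrow> E \<in> graphs N \<Longrightarrow>
    S \<noteq> {} \<Longrightarrow> S \<subseteq> N \<Longrightarrow>
    I N (lin_comb N \<alpha>\<^sub>1 v\<^sub>1 \<alpha>\<^sub>2 v\<^sub>2) E S = \<alpha>\<^sub>1 * I N v\<^sub>1 E S + \<alpha>\<^sub>2 * I N v\<^sub>2 E S"
  by (simp add: linearity_def)

text \<open>Every game is the combination of unanimity games with its dividends as
  coefficients.\<close>

lemma indices_eq_if_eq_on_unanimity_games:
  assumes lin: "linearity I" "linearity J" and N: "N \<in> player_sets" and E: "E \<in> graphs N"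
    and S: "S \<noteq> {}" "S \<subseteq> N" and v: "v \<in> games N"
    and eq: "\<And>T. T \<noteq> {} \<Longrightarrow> T \<subseteq> N \<Longrightarrow> I N (unanimity_game N T) E S = J N (unanimity_game N T) E S"
  shows "I N v E S = J N v E S"
proof -
  note fin = finite_player_set[OF N]
  \<comment> \<open>Partial sums of this expansion. Linearity takes two games at a time, so summands
    are added singly and membership in \<open>games N\<close> is carried along.\<close>
  let ?c = "\<lambda>F. \<lambda>A\<in>Pow N. \<Sum>T\<in>F. dividend v T * (if T \<subseteq> A then 1 else 0)"
  have agree: "I N (?c F) E S = J N (?c F) E S \<and> ?c F \<in> games N"
    if "finite F" "F \<subseteq> Pow N - {{}}" for F
    using that
  proof (induction F rule: finite_induct)
    case empty
    have z: "?c {} \<in> games N" by (simp add: games_def)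
    \<comment> \<open>The empty sum is the zero game, where linearity with both coefficients 0
      forces the value 0.\<close>
    have "lin_comb N 0 (?c {}) 0 (?c {}) = ?c {}" by (auto simp: lin_comb_def)
    then have "I N (?c {}) E S = 0" "J N (?c {}) E S = 0"
      using linearityD[OF lin(1) N z z E S, of 0 0] linearityD[OF lin(2) N z z E S, of 0 0]
      by simp_all
    then show ?case using z by metis
  next
    case (insert T F)
    have T: "T \<noteq> {}" "T \<subseteq> N" using insert.prems by auto
    have IH: "I N (?c F) E S = J N (?c F) E S" "?c F \<in> games N"
      using insert.IH insert.prems by blast+
    note u = unanimity_game_in_games[OF T(1), of N]
    have c: "?c (insert T F) = lin_comb N 1 (?c F) (dividend v T) (unanimity_game N T)"
      using insert.hyps by (auto simp: lin_comb_def unanimity_game_def intro!: restrict_ext)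
    have "I N (?c (insert T F)) E S = J N (?c (insert T F)) E S"
      unfolding c linearityD[OF lin(1) N IH(2) u E S] linearityD[OF lin(2) N IH(2) u E S]
        IH(1) eq[OF T] ..
    moreover have "?c (insert T F) \<in> games N"
      using IH(2) u unfolding c games_def by (simp add: lin_comb_def)
    ultimately show ?case by blast
  qed
  have "?c (Pow N - {{}}) = v"
  proof
    fix A
    show "?c (Pow N - {{}}) A = v A"
    proof (cases "A \<subseteq> N")
      case True
      have "(\<Sum>T\<in>Pow N - {{}}. dividend v T * (if T \<subseteq> A then 1 else 0))
          = (\<Sum>T\<in>Pow A - {{}}. dividend v T * (if T \<subseteq> A then 1 else 0))"
        using True fin by (intro sum.mono_neutral_right) auto
      also have "\<dots> = (\<Sum>T\<in>Pow A - {{}}. dividend v T)"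
        by (intro sum.cong refl) auto
      also have "\<dots> = v A"
        using finite_subset[OF True fin] game_empty[OF v] by (rule sum_dividend_nonempty)
      finally show ?thesis using True by simp
    next
      case False
      \<comment> \<open>Games are extensional, so both sides take this value off
        \<open>Pow N\<close>.\<close>
      then have "v A = undefined"
        using v by (auto simp: games_def intro: extensional_arb)
      then show ?thesis using False by simp
    qed
  qed
  with agree[of "Pow N - {{}}"] show ?thesis
    using fin by (simp only: finite_Diff finite_Pow_iff subset_refl)
qed

text \<open>
  A set is seen as a configuration of indistinguishable tokens on the nodes. If the node \<open>b\<close> on the
  path from \<open>a\<close> to \<open>c\<close> carries a token, that token moves on to \<open>c\<close> and the token of \<open>a\<close> takes
  its place.
\<close>

lemma slide_token:
  assumes edge: "\<And>i j S. {i, j} \<in> E \<Longrightarrow> S \<subseteq> N - {i, j} \<Longrightarrow> f (insert i S) = f (insert j S)"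
    and E: "E \<in> graphs N" and ab: "(a, b) \<in> connection N E" and S: "S \<subseteq> N - {a, b}"
  shows "f (insert a S) = f (insert b S)"
proof -
  have a: "a \<in> N" and "(a, b) \<in> (adj E)\<^sup>*" using ab by (simp_all add: connection_iff)
  from this(2) S show ?thesis
  proof (induction arbitrary: S)
    case base
    show ?case ..
  next
    case (step b c)
    have bc: "{b, c} \<in> E" using step.hyps(2) by simp
    then have bcN: "b \<in> N" "c \<in> N" "b \<noteq> c"
      using graph_edge[OF E bc] by (metis doubleton_eq_iff)+
    show ?case
    proof (cases "b \<in> S")
      case False
      then have "f (insert a S) = f (insert b S)"
        using step.prems by (intro step.IH) auto
      also have "\<dots> = f (insert c S)"
        using step.prems False by (intro edge[OF bc]) auto
      finally show ?thesis .
    next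
      case True
      define S' where "S' = S - {b}"
      have S': "S = insert b S'" "b \<notin> S'" "S' \<subseteq> N - {a, b, c}"
        using True step.prems by (auto simp: S'_def)
      have "a \<noteq> b" using True step.prems by auto
      show ?thesis
      proof (cases "a = c")
        case False
        have "f (insert a S) = f (insert b (insert a S'))"
          by (simp add: S' insert_commute)
        also have "\<dots> = f (insert c (insert a S'))"
          using S'(3) a \<open>a \<noteq> b\<close> False by (intro edge[OF bc]) auto
        also have "\<dots> = f (insert a (insert c S'))"
          by (simp add: insert_commute)
        also have "\<dots> = f (insert b (insert c S'))"
          using S'(3) bcN \<open>a \<noteq> b\<close> False by (intro step.IH) auto
        also have "\<dots> = f (insert c S)"
          by (simp add: S' insert_commute)
        finally show ?thesis .
      qed simp
    qed
  qed
qed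

text \<open>Replacing a member of \<open>A - B\<close> by one of \<open>B - A\<close> preserves
  \<open>f\<close> and the size of \<open>A\<close>, and makes \<open>A - B\<close> smaller.\<close>

lemma eq_if_card_eq:
  assumes exchange: "\<And>a b S. a \<in> N \<Longrightarrow> b \<in> N \<Longrightarrow> S \<subseteq> N - {a, b} \<Longrightarrow> f (insert a S) = f (insert b S)"
    and "finite N" "A \<subseteq> N" "B \<subseteq> N" "card A = card B"
  shows "f A = f B"
  using assms(3,5)
proof (induction "card (A - B)" arbitrary: A)
  case 0
  have "finite A" "finite B" using 0 assms by (auto intro: finite_subset)
  then have "A \<subseteq> B" using 0 by auto
  then have "A = B" using card_subset_eq[OF \<open>finite B\<close>] 0 by blast
  then show ?case by simp
next
  case (Suc n)
  have fin: "finite A" "finite B" using Suc assms by (auto intro: finite_subset)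
  have "card (B - A) = card (A - B)"
    using fin Suc.prems(2) by (metis card_le_sym_Diff le_antisym order_refl)
  then have "A - B \<noteq> {}" "B - A \<noteq> {}" using Suc.hyps(2) by (metis card.empty nat.distinct(1))+
  then obtain a b where ab: "a \<in> A" "a \<notin> B" "b \<in> B" "b \<notin> A" by auto
  define A' where "A' = insert b (A - {a})"
  have "A = insert a (A - {a})" using ab by auto
  then have "f A = f (insert a (A - {a}))" by simp
  also have "\<dots> = f A'"
    unfolding A'_def using ab Suc.prems assms by (intro exchange) auto
  also have "\<dots> = f B"
  proof (rule Suc.hyps(1))
    have "A' - B = (A - B) - {a}" using ab by (auto simp: A'_def)
    then show "n = card (A' - B)" using Suc.hyps(2) ab by simp
    show "A' \<subseteq> N" using Suc.prems ab assms by (auto simp: A'_def)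
    have "card A' = Suc (card (A - {a}))" using fin ab by (simp add: A'_def)
    also have "\<dots> = card A" using fin(1) ab(1) by (rule card.remove[symmetric])
    finally show "card A' = card B" using Suc.prems by simp
  qed
  finally show ?case .
qed

lemma graph_interaction_indexD:
  assumes "graph_interaction_index I" "N \<in> player_sets" "v \<in> games N" "E \<in> graphs N"
    "S \<noteq> {}" "S \<subseteq> N"
  shows "(\<And>C. C \<in> components N E \<Longrightarrow> \<not> S \<subseteq> C) \<Longrightarrow> I N v E S = 0"
    and "C \<in> components N E \<Longrightarrow> S \<subseteq> C \<Longrightarrow> I N v E S = I C (subgame v C) (induced E C) S"
  using assms unfolding graph_interaction_index_def by meson+

lemma component_efficiencyD:
  "component_efficiency I \<Longrightarrow> N \<in> player_sets \<Longrightarrow> v \<in> games N \<Longrightarrow> E \<in> graphs N \<Longrightarrow>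
    C \<in> components N E \<Longrightarrow> (\<Sum>i\<in>C. I N v E {i}) = v C"
  by (simp add: component_efficiency_def)

lemma fairnessD:
  "fairness I \<Longrightarrow> N \<in> player_sets \<Longrightarrow> v \<in> games N \<Longrightarrow> E \<in> graphs N \<Longrightarrow> {i, j} \<in> E \<Longrightarrow>
    S \<subseteq> N - {i, j} \<Longrightarrow>
    I N v E (insert i S) - I N v (E - {{i, j}}) (insert i S) =
    I N v E (insert j S) - I N v (E - {{i, j}}) (insert j S)"
  unfolding fairness_def by blast

lemma graph_nullD:
  "graph_null I \<Longrightarrow> N \<in> player_sets \<Longrightarrow> v \<in> games N \<Longrightarrow> E \<in> graphs N \<Longrightarrow>
    graph_null_player N v E i \<Longrightarrow> S \<subseteq> N - {i} \<Longrightarrow> I N v E (insert i S) = 0"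
  by (simp add: graph_null_def)

lemma strong_reduced_veto_partnership_consistencyD:
  "strong_reduced_veto_partnership_consistency proxy I \<Longrightarrow> N \<in> player_sets \<Longrightarrow> v \<in> games N \<Longrightarrow>
    E \<in> graphs N \<Longrightarrow> veto_graph_partnership N v E P \<Longrightarrow> S \<subseteq> N - P \<Longrightarrow>
    I N v E (P \<union> S) =
      I (quotient_players N P (proxy N P)) (quotient_game N (restricted_game N v E) P (proxy N P))
        (quotient_graph N E P (proxy N P)) (insert (proxy N P) S)"
  by (simp add: strong_reduced_veto_partnership_consistency_def Let_def)

lemma subgame_self: "v \<in> games N \<Longrightarrow> subgame v N = v"
  by (simp add: subgame_def games_def extensional_restrict)

section \<open>Unanimity games on connected graphs\<close>

text \<open>The veto partnership behind \<open>P\<close> is \<open>T\<close> itself, of which a veto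
  graph partnership may be any non-empty part. This allows merging two members of \<open>T\<close>
  without the others.\<close>

lemma veto_graph_partnership_unanimity_game:
  assumes "E \<in> graphs N" "N \<in> components N E" "T \<subseteq> N" "P \<subseteq> T" "P \<noteq> {}"
  shows "veto_graph_partnership N (unanimity_game N T) E P"
proof -
  have T: "T \<noteq> {}" using assms by auto
  have N: "subgame (unanimity_game N T) N = unanimity_game N T" "induced E N = E"
    using unanimity_game_in_games[OF T, of N] assms(1) by (simp_all add: subgame_self induced_graph)
  have "veto_partnership N (unanimity_game N T) T"
    unfolding veto_partnership_def
  proof (intro conjI allI impI; (elim conjE)?)
    fix A R assume A: "A \<subseteq> N - T" and R: "R \<subset> T"
    have "\<not> T \<subseteq> A \<union> R" "\<not> T \<subseteq> A" "A \<union> R \<subseteq> N" "A \<subseteq> N" using A R T assms(3) by blast+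
    then show "unanimity_game N T (A \<union> R) = unanimity_game N T A" "unanimity_game N T A = 0"
      by (simp_all add: unanimity_game_def)
  qed (use T assms in auto)
  then have "veto_graph_partnership_conn N (unanimity_game N T) E P"
    using assms by (auto simp: veto_graph_partnership_conn_def)
  then show ?thesis
    unfolding veto_graph_partnership_def using assms(2) N by (intro bexI[of _ N]) simp_all
qed

text \<open>All players but \<open>t\<close> are null, and of two distinct players at least one is
  not \<open>t\<close>.\<close>

lemma graph_null_player_unanimity_game_singleton:
  assumes "E \<in> graphs N" "N \<in> components N E" "t \<in> N" "i \<in> N" "i \<noteq> t"
  shows "graph_null_player N (unanimity_game N {t}) E i"
proof -
  have N: "subgame (unanimity_game N {t}) N = unanimity_game N {t}" "induced E N = E"
    using unanimity_game_in_games[of "{t}" N] assms(1)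
    by (simp_all add: subgame_self induced_graph)
  have null: "null_player N (unanimity_game N {t}) k" if "k \<in> N" "k \<noteq> t" for k
    using that by (auto simp: null_player_def unanimity_game_def)
  then have "graph_null_player_conn N (unanimity_game N {t}) E i"
    using assms(4,5) unfolding graph_null_player_conn_def by blast
  then show ?thesis
    unfolding graph_null_player_def using assms(2) N by (intro bexI[of _ N]) simp_all
qed

section \<open>Agreement of any two indices that satisfy the axioms\<close>

lemma graph_interaction_indices_agree:
  assumes proxy: "proxy_choice proxy"
    and I: "graph_interaction_index I" "myerson_axioms proxy I"
    and J: "graph_interaction_index J" "myerson_axioms proxy J"
  shows "N \<in> player_sets \<Longrightarrow> v \<in> games N \<Longrightarrow> E \<in> graphs N \<Longrightarrow> S \<noteq> {} \<Longrightarrow> S \<subseteq> N \<Longrightarrow>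
    I N v E S = J N v E S"
\<comment> \<open>Game, graph and coalition stay arbitrary, since a quotient changes them together
  with the players.\<close>
proof (induction "card N" arbitrary: N v E S rule: less_induct)
  case (less N)
  note smaller_players = less.hyps and N = less.prems(1)
  note fin = finite_player_set[OF N]
  note axioms = I(2)[unfolded myerson_axioms_def] J(2)[unfolded myerson_axioms_def]
  from less.prems(2-) show ?case
  proof (induction "card E" arbitrary: v E S rule: less_induct)
    case (less E)
    note smaller_edges = less.hyps and v = less.prems(1) and E = less.prems(2) and S = less.prems(3,4)
    show ?case
    proof (cases "N \<in> components N E")
      \<comment> \<open>Each component has fewer players, so locality and the outer induction
        hypothesis settle sets inside one; both indices are 0 on all other sets.\<close>
      case False
      show ?thesis
      proof (cases "\<exists>C\<in>components N E. S \<subseteq> C")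
        case True
        then obtain C where C: "C \<in> components N E" "S \<subseteq> C" by blast
        have "C \<subset> N" using C(1) False component_props(2)[OF C(1)] by auto
        then have "I C (subgame v C) (induced E C) S = J C (subgame v C) (induced E C) S"
          using C S fin player_set_subset[OF N] component_props(1)[OF C(1)]
          by (intro smaller_players psubset_card_mono subgame_in_games[OF v] induced_in_graphs[OF E])
            auto
        then show ?thesis
          using graph_interaction_indexD(2)[OF I(1) N v E S C]
            graph_interaction_indexD(2)[OF J(1) N v E S C] by simp
      next
        case False
        then show ?thesis
          using graph_interaction_indexD(1)[OF I(1) N v E S]
            graph_interaction_indexD(1)[OF J(1) N v E S] by auto
      qed
    next
      case True
      note connected = True
      show ?thesis
      proof (rule indices_eq_if_eq_on_unanimity_games[OF _ _ N E S v])
        fix T assume T: "T \<noteq> {}" "T \<subseteq> N"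
        let ?u = "unanimity_game N T"
        note u = unanimity_game_in_games[OF T(1), of N]
        define f where "f = (\<lambda>S. I N ?u E S - J N ?u E S)"
        have edge: "f (insert i S) = f (insert j S)" if ij: "{i, j} \<in> E" and S: "S \<subseteq> N - {i, j}" for i j S
        proof -
          let ?E = "E - {{i, j}}"
          have "finite E"
            using E fin by (auto simp: graphs_def intro: finite_subset[of _ "Pow N"])
          then have less: "card ?E < card E" using ij by (rule card_Diff1_less)
          have E': "?E \<in> graphs N" using E by (auto simp: graphs_def)
          have "i \<in> N" "j \<in> N" using graph_edge[OF E ij] by (metis doubleton_eq_iff)+
          then have "I N ?u ?E (insert i S) = J N ?u ?E (insert i S)"
            "I N ?u ?E (insert j S) = J N ?u ?E (insert j S)"
            using S by (auto intro!: smaller_edges[OF less u E'])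
          \<comment> \<open>Without the edge the indices agree, so subtracting the two fairness
            equations leaves only the terms with the edge.\<close>
          then show ?thesis
            using fairnessD[of I, OF _ N u E ij S] fairnessD[of J, OF _ N u E ij S] axioms
            by (simp add: f_def)
        qed
        have f_card: "f A = f B" if "A \<subseteq> N" "B \<subseteq> N" "card A = card B" for A B
        proof (rule eq_if_card_eq[OF _ fin that])
          fix a b S assume "a \<in> N" "b \<in> N" and S: "S \<subseteq> N - {a, b}"
          then have "(a, b) \<in> connection N E" using component_props(3)[OF connected] by blast
          then show "f (insert a S) = f (insert b S)"
            using slide_token[of E N f, OF edge E _ S] by blast
        qed
        have "f S = 0"
        proof (cases "card S = 1")
          case True
          \<comment> \<open>All singletons share one value of \<open>f\<close>, and by efficiency
            these values sum to zero over the non-empty \<open>N\<close>.\<close>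
          have "f {i} = f S" if "i \<in> N" for i
            using that S True by (intro f_card) auto
          then have "(\<Sum>i\<in>N. f {i}) = real (card N) * f S" by simp
          moreover have "(\<Sum>i\<in>N. f {i}) = 0"
            using component_efficiencyD[of I, OF _ N u E connected]
              component_efficiencyD[of J, OF _ N u E connected] axioms
            by (simp add: f_def sum_subtractf)
          moreover have "card N \<noteq> 0" using N fin by (simp add: player_sets_def)
          ultimately show ?thesis by simp
        next
          case False
          have finS: "finite S" using S fin by (simp add: finite_subset)
          then have card_S: "card S \<ge> 2" using S False by (cases "card S") auto
          show ?thesis
          proof (cases "\<exists>a\<in>T. \<exists>b\<in>T. a \<noteq> b")
            case True
            then obtain a b where ab: "a \<in> T" "b \<in> T" "a \<noteq> b" by blast
            \<comment> \<open>Only two members of \<open>T\<close> are merged: a set that contains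
              them can have any size from 2 to \<open>card N\<close>, hence also that of
              \<open>S\<close>.\<close>
            let ?P = "{a, b}"
            have P: "?P \<subseteq> N" "?P \<noteq> {}" using ab T by auto
            let ?p = "proxy N ?P"
            let ?N = "quotient_players N ?P ?p"
            have card_P: "card (N - ?P) = card N - 2"
              using ab(3) P(1) by (simp add: card_Diff_subset)
            have card_N: "card S \<le> card N" using S(2) fin by (simp add: card_mono)
            have "card S - 2 \<le> card (N - ?P)" using card_N by (simp add: card_P)
            then obtain R where R: "R \<subseteq> N - ?P" "card R = card S - 2" "finite R"
              by (rule obtain_subset_with_card_n)
            have "card ?N \<le> Suc (card (N - ?P))"
              unfolding quotient_players_def using fin by (simp add: card_insert_if)
            \<comment> \<open>Two players give way to at most one new player;
              \<open>card N \<ge> card S \<ge> 2\<close> keeps \<open>card N - 2\<close> from being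
              truncated.\<close>
            then have less: "card ?N < card N" using card_P card_N card_S by linarith
            note p = proxy_choiceD[OF proxy N P(2,1)]
            have "I ?N (quotient_game N (restricted_game N ?u E) ?P ?p) (quotient_graph N E ?P ?p) (insert ?p R)
              = J ?N (quotient_game N (restricted_game N ?u E) ?P ?p) (quotient_graph N E ?P ?p) (insert ?p R)"
            proof (rule smaller_players[OF less p(2)])
              show "quotient_game N (restricted_game N ?u E) ?P ?p \<in> games ?N"
                by (rule quotient_game_in_games[OF restricted_game_in_games])
              show "quotient_graph N E ?P ?p \<in> graphs ?N"
                by (rule quotient_graph_in_graphs[OF E p(1)])
            qed (use R in \<open>auto simp: quotient_players_def\<close>)
            moreover have "veto_graph_partnership N ?u E ?P"
              using ab by (intro veto_graph_partnership_unanimity_game[OF E connected T(2)]) auto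
            ultimately have "f (?P \<union> R) = 0"
              using strong_reduced_veto_partnership_consistencyD[of proxy I, OF _ N u E _ R(1)]
                strong_reduced_veto_partnership_consistencyD[of proxy J, OF _ N u E _ R(1)] axioms
              unfolding f_def by auto
            moreover have "card (?P \<union> R) = card S"
            proof -
              have "?P \<inter> R = {}" using R(1) by auto
              then have "card (?P \<union> R) = card ?P + card R" using R(3) by (intro card_Un_disjoint) auto
              then show ?thesis using ab(3) R(2) card_S by simp
            qed
            then have "f S = f (?P \<union> R)" using S P R by (intro f_card) auto
            ultimately show ?thesis by simp
          next
            case False
            then obtain t where t: "T = {t}" using T by blast
            \<comment> \<open>Here \<open>S\<close> needs no replacement: having two members, it
              contains a graph null player, and both indices vanish on it.\<close>
            obtain i where i: "i \<in> S" "i \<noteq> t"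
            proof (rule ccontr)
              assume "\<not> thesis"
              then have "S \<subseteq> {t}" using that by blast
              then have "card S \<le> 1" using card_mono[of "{t}" S] by simp
              then show False using card_S by simp
            qed
            have null: "graph_null_player N ?u E i"
              unfolding t using i S T t
              by (intro graph_null_player_unanimity_game_singleton[OF E connected]) auto
            have rest: "S - {i} \<subseteq> N - {i}" using S by auto
            have "I N ?u E (insert i (S - {i})) = 0" "J N ?u E (insert i (S - {i})) = 0"
              using graph_nullD[of I, OF _ N u E null rest] graph_nullD[of J, OF _ N u E null rest]
                axioms by blast+
            then show ?thesis using i by (simp add: f_def insert_absorb)
          qed
        qed
        then show "I N ?u E S = J N ?u E S" by (simp add: f_def)
      qed (use axioms in auto)
    qed
  qed
qed

theorem theorem1:
  fixes proxy :: "player set \<Rightarrow> player set \<Rightarrow> player"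
  assumes "proxy_choice proxy"
  shows "graph_interaction_index MI \<and> myerson_axioms proxy MI \<and>
    (\<forall>GI. graph_interaction_index GI \<and> myerson_axioms proxy GI \<longrightarrow>
       (\<forall>N\<in>player_sets. \<forall>v\<in>games N. \<forall>E\<in>graphs N. \<forall>S. S \<noteq> {} \<and> S \<subseteq> N \<longrightarrow>
          GI N v E S = MI N v E S))"
proof -
  have "myerson_axioms proxy MI"
    unfolding myerson_axioms_def
    using component_efficiency_MI fairness_MI graph_null_MI linearity_MI
      strong_reduced_veto_partnership_consistency_MI[OF assms] by blast
  then show ?thesis
    using graph_interaction_index_MI graph_interaction_indices_agree[OF assms] by blast
qed

end
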